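(* For $i=1,2$ let $H_i:\mathbb R\to\mathbb R$ be convex and Lipschitz, $\sigma_i>0$ constants, $\nu_i$ probability densities with finite first moment. Let $F_i,G_i$ be such that $x\mapsto F_i(x,\mu_1,\mu_2)$ and $x\mapsto G_i(x,\mu_1,\mu_2)$ depend on $(\mu_1,\mu_2)$ only through $(M(\mu_1),M(\mu_2))$, grow at most linearly in $x$ uniformly for bounded $\int|x|d\mu_i$, and for some $\lambda_1,\lambda_2>0$ and all $(\mu_1,\mu_2),(\bar\mu_1,\bar\mu_2)\in\mathcal P_1(\mathbb R)^2$ with $C^2$ densities: $$\int\sum_{i=1}^2\lambda_i[F_i(x,\mu_1,\mu_2)-F_i(x,\bar\mu_1,\bar\mu_2)]\,d(\mu_i-\bar\mu_i)(x)>0\quad\text{if }M(\mu_1)\ne M(\bar\mu_1)\text{ or }M(\mu_2)\ne M(\bar\mu_2),$$ $$\int\sum_{i=1}^2\lambda_i[G_i(x,\mu_1,\mu_2)-G_i(x,\bar\mu_1,\bar\mu_2)]\,d(\mu_i-\bar\mu_i)(x)\ge0.$$ Then the system, for $i=1,2$ on $(0,T)\times\mathbb R$, $$-\partial_tv_i+H_i(\partial_xv_i)=\tfrac12\sigma_i^2\partial_{xx}v_i+F_i(x,m_1(t),m_2(t)),\ v_i(T,x)=G_i(x,m_1(T),m_2(T));\ \partial_tm_i-(H_i'(\partial_xv_i)m_i)_x=\tfrac12\sigma_i^2\partial_{xx}m_i,\ m_i(0,\cdot)=\nu_i,$$ has at most one classical solution $(v_1,v_2,m_1,m_2)$ such that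 each $v_i$ and its derivatives are bounded by $C(1+|x|)$.
   Context: $\mathcal P_1(\mathbb R)$: probability measures with finite first moment; $M(\mu)=\int x\,d\mu$. Classical solution: $C^{1,2}$ functions satisfying the equations pointwise (with $H_i$ differentiable at $\partial_xv_i(t,x)$), $m_i(t,\cdot)$ probability densities. *)

theory Defs
  imports "HOL-Analysis.Analysis" "HOL-Probability.Probability"
begin

definition P1 :: "real measure set" where
  "P1 = {\<mu>. prob_space \<mu> \<and> sets \<mu> = sets borel \<and> integrable \<mu> (\<lambda>x. x)}"

definition Mean :: "real measure \<Rightarrow> real" where
  "Mean \<mu> = (\<integral>x. x \<partial>\<mu>)"

definition dens :: "(real \<Rightarrow> real) \<Rightarrow> real measure" where
  "dens p = density lborel (\<lambda>x. ennreal (p x))"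

definition pdens1 :: "(real \<Rightarrow> real) \<Rightarrow> bool" where
  "pdens1 p \<longleftrightarrow> p \<in> borel_measurable lborel \<and> (\<forall>x. 0 \<le> p x) \<and>
     integrable lborel p \<and> (\<integral>x. p x \<partial>lborel) = 1 \<and>
     integrable lborel (\<lambda>x. x * p x)"

definition C2fun :: "(real \<Rightarrow> real) \<Rightarrow> bool" where
  "C2fun p \<longleftrightarrow> (\<forall>x. p differentiable (at x)) \<and> (\<forall>x. deriv p differentiable (at x)) \<and>
     continuous_on UNIV (deriv (deriv p))"

definition dt :: "(real \<Rightarrow> real \<Rightarrow> real) \<Rightarrow> real \<Rightarrow> real \<Rightarrow> real" where
  "dt f t x = deriv (\<lambda>s. f s x) t"
definition dx :: "(real \<Rightarrow> real \<Rightarrow> real) \<Rightarrow> real \<Rightarrow> real \<Rightarrow> real" where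
  "dx f t x = deriv (\<lambda>y. f t y) x"
definition dxx :: "(real \<Rightarrow> real \<Rightarrow> real) \<Rightarrow> real \<Rightarrow> real \<Rightarrow> real" where
  "dxx f t x = deriv (\<lambda>y. dx f t y) x"

definition C12 :: "real \<Rightarrow> (real \<Rightarrow> real \<Rightarrow> real) \<Rightarrow> bool" where
  "C12 T f \<longleftrightarrow>
     continuous_on ({0..T} \<times> UNIV) (\<lambda>(t,x). f t x) \<and>
     (\<forall>t\<in>{0<..<T}. \<forall>x. (\<lambda>s. f s x) differentiable (at t) \<and>
        (\<lambda>y. f t y) differentiable (at x) \<and> (\<lambda>y. dx f t y) differentiable (at x)) \<and>
     continuous_on ({0<..<T} \<times> UNIV) (\<lambda>(t,x). dt f t x) \<and>
     continuous_on ({0<..<T} \<times> UNIV) (\<lambda>(t,x). dx f t x) \<and>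
     continuous_on ({0<..<T} \<times> UNIV) (\<lambda>(t,x). dxx f t x)"

definition depends_on_means :: "(real \<Rightarrow> real measure \<Rightarrow> real measure \<Rightarrow> real) \<Rightarrow> bool" where
  "depends_on_means \<Phi> \<longleftrightarrow> (\<forall>\<mu>1\<in>P1. \<forall>\<mu>2\<in>P1. \<forall>\<mu>1'\<in>P1. \<forall>\<mu>2'\<in>P1.
      Mean \<mu>1 = Mean \<mu>1' \<and> Mean \<mu>2 = Mean \<mu>2' \<longrightarrow> (\<forall>x. \<Phi> x \<mu>1 \<mu>2 = \<Phi> x \<mu>1' \<mu>2'))"

definition linear_growth :: "(real \<Rightarrow> real measure \<Rightarrow> real measure \<Rightarrow> real) \<Rightarrow> bool" where
  "linear_growth \<Phi> \<longleftrightarrow> (\<forall>R. \<exists>C. \<forall>\<mu>1\<in>P1. \<forall>\<mu>2\<in>P1.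
      (\<integral>x. \<bar>x\<bar> \<partial>\<mu>1) \<le> R \<and> (\<integral>x. \<bar>x\<bar> \<partial>\<mu>2) \<le> R \<longrightarrow> (\<forall>x. \<bar>\<Phi> x \<mu>1 \<mu>2\<bar> \<le> C * (1 + \<bar>x\<bar>)))"

definition LL_sum :: "(nat \<Rightarrow> real) \<Rightarrow> (nat \<Rightarrow> real \<Rightarrow> real measure \<Rightarrow> real measure \<Rightarrow> real) \<Rightarrow>
     real measure \<Rightarrow> real measure \<Rightarrow> real measure \<Rightarrow> real measure \<Rightarrow> real" where
  "LL_sum lam \<Phi> \<mu>1 \<mu>2 \<mu>b1 \<mu>b2 =
     lam 1 * ((\<integral>x. \<Phi> 1 x \<mu>1 \<mu>2 - \<Phi> 1 x \<mu>b1 \<mu>b2 \<partial>\<mu>1) - (\<integral>x. \<Phi> 1 x \<mu>1 \<mu>2 - \<Phi> 1 x \<mu>b1 \<mu>b2 \<partial>\<mu>b1))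
   + lam 2 * ((\<integral>x. \<Phi> 2 x \<mu>1 \<mu>2 - \<Phi> 2 x \<mu>b1 \<mu>b2 \<partial>\<mu>2) - (\<integral>x. \<Phi> 2 x \<mu>1 \<mu>2 - \<Phi> 2 x \<mu>b1 \<mu>b2 \<partial>\<mu>b2))"

definition MFG_solution :: "real \<Rightarrow> (nat \<Rightarrow> real \<Rightarrow> real) \<Rightarrow> (nat \<Rightarrow> real) \<Rightarrow>
     (nat \<Rightarrow> real \<Rightarrow> real measure \<Rightarrow> real measure \<Rightarrow> real) \<Rightarrow>
     (nat \<Rightarrow> real \<Rightarrow> real measure \<Rightarrow> real measure \<Rightarrow> real) \<Rightarrow> (nat \<Rightarrow> real \<Rightarrow> real) \<Rightarrow>
     (nat \<Rightarrow> real \<Rightarrow> real \<Rightarrow> real) \<Rightarrow> (nat \<Rightarrow> real \<Rightarrow> real \<Rightarrow> real) \<Rightarrow> bool" where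
  "MFG_solution T H \<sigma> F G \<nu> v m \<longleftrightarrow> (\<forall>i\<in>{1,2}.
     C12 T (v i) \<and> C12 T (m i) \<and>
     (\<forall>t\<in>{0..T}. pdens1 (m i t)) \<and>
     (\<forall>t\<in>{0<..<T}. \<forall>x.
        H i differentiable (at (dx (v i) t x)) \<and>
        (\<lambda>y. deriv (H i) (dx (v i) t y) * m i t y) differentiable (at x) \<and>
        - dt (v i) t x + H i (dx (v i) t x)
          = (\<sigma> i)\<^sup>2 / 2 * dxx (v i) t x + F i x (dens (m 1 t)) (dens (m 2 t)) \<and>
        dt (m i) t x - deriv (\<lambda>y. deriv (H i) (dx (v i) t y) * m i t y) x
          = (\<sigma> i)\<^sup>2 / 2 * dxx (m i) t x) \<and>
     (\<forall>x. v i T x = G i x (dens (m 1 T)) (dens (m 2 T))) \<and>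
     (\<forall>x. m i 0 x = \<nu> i x) \<and>
     (\<exists>C. (\<forall>t\<in>{0..T}. \<forall>x. \<bar>v i t x\<bar> \<le> C * (1 + \<bar>x\<bar>)) \<and>
          (\<forall>t\<in>{0<..<T}. \<forall>x. \<bar>dt (v i) t x\<bar> \<le> C * (1 + \<bar>x\<bar>) \<and>
             \<bar>dx (v i) t x\<bar> \<le> C * (1 + \<bar>x\<bar>) \<and> \<bar>dxx (v i) t x\<bar> \<le> C * (1 + \<bar>x\<bar>))))"

end

theory Submission
  imports Defs
begin

text \<open>
  Lasry--Lions duality: with \<open>w\<^sub>i = v\<^sub>i - v'\<^sub>i\<close>, convexity of \<open>H\<^sub>i\<close> makes
  \<open>\<Sum> \<lambda>\<^sub>i \<integral> w\<^sub>i d(m\<^sub>i - m'\<^sub>i)\<close> decrease at least at the rate given by the monotonicity expression of \<open>F\<close>,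
  while it vanishes at time \<open>0\<close> and is nonnegative at time \<open>T\<close>; so the means agree at all times and both
  systems decouple. The value functions then coincide by a maximum principle with a quadratic barrier, and the
  densities, which now solve the same linear equation, by Kato's inequality in \<open>L\<^sup>1\<close>.
  No decay of the derivatives of the densities is available, so every integration by parts is done against a
  cutoff, and the errors are controlled by first moments that are uniformly integrable in time
  (test against \<open>sqrt (r\<^sup>2 + x\<^sup>2) - r\<close>). Derivatives in time are bounded uniformly in the cutoff, so
  no integral over time is needed.
\<close>

section \<open>Cutoffs and tails\<close>

text \<open>A polynomial suffices as cutoff, because it is only used on \<open>{- R..R}\<close> and boundary terms only see
  the function and its first derivative.\<close>

definition cutoff :: "real \<Rightarrow> real \<Rightarrow> real" where
  "cutoff R x = (1 - (x / R)\<^sup>2)\<^sup>2"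

definition cutoff' :: "real \<Rightarrow> real \<Rightarrow> real" where
  "cutoff' R x = - 4 * x / R\<^sup>2 * (1 - (x / R)\<^sup>2)"

definition cutoff'' :: "real \<Rightarrow> real \<Rightarrow> real" where
  "cutoff'' R x = - 4 / R\<^sup>2 + 12 * x\<^sup>2 / R ^ 4"

lemma cutoff_derivs:
  assumes "R \<noteq> 0"
  shows "(cutoff R has_real_derivative cutoff' R x) (at x within S)"
    and "(cutoff' R has_real_derivative cutoff'' R x) (at x within S)"
  unfolding cutoff_def cutoff'_def cutoff''_def using assms
  by (auto intro!: derivative_eq_intros simp: field_simps power2_eq_square eval_nat_numeral)

lemma cutoff_boundary [simp]:
  assumes "R \<noteq> 0"
  shows "cutoff R R = 0" "cutoff R (- R) = 0" "cutoff' R R = 0" "cutoff' R (- R) = 0"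
  using assms by (auto simp: cutoff_def cutoff'_def)

lemma continuous_on_cutoff [continuous_intros]:
  assumes "R \<noteq> 0" "continuous_on S f"
  shows "continuous_on S (\<lambda>x. cutoff R (f x))" "continuous_on S (\<lambda>x. cutoff' R (f x))"
    "continuous_on S (\<lambda>x. cutoff'' R (f x))"
  unfolding cutoff_def cutoff'_def cutoff''_def using assms
  by (auto intro!: continuous_intros)

lemma cutoff_bounds:
  assumes "R \<ge> 1" "x \<in> {- R..R}"
  shows "0 \<le> cutoff R x" "cutoff R x \<le> 1" "\<bar>cutoff' R x\<bar> \<le> 4 / R" "\<bar>cutoff'' R x\<bar> \<le> 8 / R"
    "1 - cutoff R x \<le> 2 * (x / R)\<^sup>2"
proof -
  define y where "y = x / R"
  have y: "\<bar>y\<bar> \<le> 1" using assms by (auto simp: y_def abs_le_iff field_simps)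
  then have y2: "y\<^sup>2 \<le> 1" "0 \<le> y\<^sup>2" by (auto simp: abs_square_le_1)
  show "0 \<le> cutoff R x" by (simp add: cutoff_def)
  show "cutoff R x \<le> 1" unfolding cutoff_def y_def[symmetric]
    using y2 by (simp add: abs_square_le_1)
  show "1 - cutoff R x \<le> 2 * (x / R)\<^sup>2" unfolding cutoff_def y_def[symmetric]
    using zero_le_power2[of "y\<^sup>2"] by (simp add: power2_eq_square algebra_simps)
  have "cutoff' R x = - 4 / R * (y * (1 - y\<^sup>2))"
    by (simp add: cutoff'_def y_def power2_eq_square)
  moreover have "\<bar>y * (1 - y\<^sup>2)\<bar> \<le> 1 * 1"
    unfolding abs_mult by (rule mult_mono) (use y y2 in auto)
  ultimately show "\<bar>cutoff' R x\<bar> \<le> 4 / R"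
    using assms by (simp add: abs_mult divide_right_mono)
  have "cutoff'' R x = (12 * y\<^sup>2 - 4) / R\<^sup>2"
    using assms by (simp add: cutoff''_def y_def field_simps power2_eq_square eval_nat_numeral)
  moreover have "\<bar>12 * y\<^sup>2 - 4\<bar> \<le> 8" unfolding abs_le_iff using y2 by linarith
  ultimately have "\<bar>cutoff'' R x\<bar> \<le> 8 / R\<^sup>2"
    by (simp add: divide_right_mono)
  also have "\<dots> \<le> 8 / R"
    using assms by (intro divide_left_mono) (auto simp: power2_eq_square)
  finally show "\<bar>cutoff'' R x\<bar> \<le> 8 / R" .
qed

lemma cutoff_by_parts:
  fixes u u' u'' p p' p'' h h' :: "real \<Rightarrow> real"
  assumes R: "R \<ge> 1" and a: "a \<ge> 0"
    and du: "\<And>x. (u has_real_derivative u' x) (at x)" "\<And>x. (u' has_real_derivative u'' x) (at x)"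
    and dp: "\<And>x. (p has_real_derivative p' x) (at x)" "\<And>x. (p' has_real_derivative p'' x) (at x)"
    and dh: "\<And>x. (h has_real_derivative h' x) (at x)"
    and cont: "continuous_on UNIV u''" "continuous_on UNIV p''" "continuous_on UNIV h'"
    and p: "\<And>x. 0 \<le> p x" and h: "\<And>x. \<bar>h x\<bar> \<le> L * p x"
    and u: "\<And>x. \<bar>u x\<bar> \<le> C * (1 + \<bar>x\<bar>)" "\<And>x. \<bar>u' x\<bar> \<le> C * (1 + \<bar>x\<bar>)"
  shows "\<bar>integral {- R..R} (\<lambda>x. cutoff R x * u x * (h' x + a * p'' x))
      - integral {- R..R} (\<lambda>x. cutoff R x * (a * u'' x * p x - h x * u' x))\<bar>
      \<le> (16 * a + 4 * L) * C / R * integral {- R..R} (\<lambda>x. (1 + \<bar>x\<bar>) * p x)"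
proof -
  have R0: "R \<noteq> 0" using R by auto
  note cder = cutoff_derivs[OF R0]
  have c: "continuous_on S u" "continuous_on S u'" "continuous_on S p" "continuous_on S p'"
     "continuous_on S h" "continuous_on S u''" "continuous_on S p''" "continuous_on S h'" for S
    using cont du dp dh
    by (blast intro: DERIV_continuous_on has_field_derivative_at_within continuous_on_subset)+
  define Q where "Q x = cutoff R x * u x * h x + a * (cutoff R x * u x) * p' x
      - a * (cutoff' R x * u x + cutoff R x * u' x) * p x" for x
  define f where "f x = cutoff R x * u x * (h' x + a * p'' x)" for x
  define g where "g x = cutoff R x * (a * u'' x * p x - h x * u' x)" for x
  define e where "e x = a * (cutoff'' R x * u x + 2 * cutoff' R x * u' x) * p x - h x * cutoff' R x * u x" for x
  have "(Q has_real_derivative f x - g x - e x) (at x within S)" for x S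
    unfolding Q_def f_def g_def e_def
    by (rule derivative_eq_intros cder du[THEN has_field_derivative_at_within]
         dp[THEN has_field_derivative_at_within] dh[THEN has_field_derivative_at_within] refl)+
      (simp add: algebra_simps)
  then have "((\<lambda>x. f x - g x - e x) has_integral (Q R - Q (- R))) {- R..R}"
    using R by (intro fundamental_theorem_of_calculus)
      (auto simp: has_real_derivative_iff_has_vector_derivative[symmetric])
  moreover have "Q R - Q (- R) = 0" using R0 by (simp add: Q_def)
  ultimately have I: "((\<lambda>x. f x - g x - e x) has_integral 0) {- R..R}" by simp
  have int: "f integrable_on {- R..R}" "g integrable_on {- R..R}" "e integrable_on {- R..R}"
    unfolding f_def g_def e_def using R0
    by (auto intro!: integrable_continuous_interval continuous_intros c)
  have "integral {- R..R} f - integral {- R..R} g = integral {- R..R} e"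
    using I int by (simp add: integral_diff integrable_diff has_integral_iff)
  moreover have "norm (integral {- R..R} e) \<le> integral {- R..R} (\<lambda>x. (16 * a + 4 * L) * C / R * ((1 + \<bar>x\<bar>) * p x))"
  proof (rule integral_norm_bound_integral[OF int(3)])
    show "(\<lambda>x. (16 * a + 4 * L) * C / R * ((1 + \<bar>x\<bar>) * p x)) integrable_on {- R..R}"
      by (intro integrable_continuous_interval continuous_intros c)
    fix x assume x: "x \<in> {- R..R}"
    note b = cutoff_bounds[OF R x]
    let ?X = "C * (1 + \<bar>x\<bar>)"
    have X: "0 \<le> ?X" using u(1)[of x] by linarith
    have 1: "\<bar>cutoff'' R x * u x\<bar> \<le> 8 / R * ?X"
      unfolding abs_mult by (rule mult_mono[OF b(4) u(1)]) (use R in simp_all)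
    have 2: "\<bar>cutoff' R x * u' x\<bar> \<le> 4 / R * ?X"
      unfolding abs_mult by (rule mult_mono[OF b(3) u(2)]) (use R in simp_all)
    have 3: "\<bar>cutoff' R x * u x\<bar> \<le> 4 / R * ?X"
      unfolding abs_mult by (rule mult_mono[OF b(3) u(1)]) (use R in simp_all)
    have "\<bar>cutoff'' R x * u x + 2 * cutoff' R x * u' x\<bar> \<le> 16 / R * ?X"
      using 1 2 by linarith
    then have 4: "\<bar>a * (cutoff'' R x * u x + 2 * cutoff' R x * u' x) * p x\<bar> \<le> a * (16 / R * ?X) * p x"
      unfolding abs_mult using a p[of x]
      by (simp only: abs_of_nonneg mult_right_mono mult_left_mono)
    have 5: "\<bar>h x * (cutoff' R x * u x)\<bar> \<le> L * p x * (4 / R * ?X)"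
      unfolding abs_mult[of "h x"] by (rule mult_mono[OF h 3 order_trans[OF abs_ge_zero h] abs_ge_zero])
    have "norm (e x) \<le> a * (16 / R * ?X) * p x + L * p x * (4 / R * ?X)"
      using abs_triangle_ineq4 4 5 unfolding e_def real_norm_def mult.assoc[of "h x"]
      by (rule order_trans[OF _ add_mono])
    also have "\<dots> = (16 * a + 4 * L) * C / R * ((1 + \<bar>x\<bar>) * p x)"
      by (simp add: algebra_simps add_divide_distrib)
    finally show "norm (e x) \<le> (16 * a + 4 * L) * C / R * ((1 + \<bar>x\<bar>) * p x)" .
  qed
  ultimately show ?thesis unfolding f_def g_def by simp
qed

definition trunc :: "real \<Rightarrow> real \<Rightarrow> real" where
  "trunc R x = indicator {- R..R} x * cutoff R x"

lemma trunc_bounds: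
  assumes "R \<ge> 1"
  shows "0 \<le> trunc R x" "trunc R x \<le> 1"
  using cutoff_bounds[OF assms, of x] by (auto simp: trunc_def indicator_def)

lemma borel_measurable_trunc [measurable]: "trunc R \<in> borel_measurable borel"
  unfolding trunc_def cutoff_def by measurable

lemma cutoff_integral_eq:
  fixes f :: "real \<Rightarrow> real"
  assumes f: "integrable lborel f" and R: "R \<ge> 1"
  shows "integrable lborel (\<lambda>x. trunc R x * f x)"
    and "integral {- R..R} (\<lambda>x. cutoff R x * f x) = (LINT x|lborel. trunc R x * f x)"
proof -
  have [measurable]: "f \<in> borel_measurable borel" using f by auto
  show I: "integrable lborel (\<lambda>x. trunc R x * f x)"
  proof (rule Bochner_Integration.integrable_bound[OF f])
    show "AE x in lborel. norm (trunc R x * f x) \<le> norm (f x)"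
      using trunc_bounds[OF R] by (auto simp: abs_mult intro!: mult_left_le_one_le)
  qed measurable
  then have "set_integrable lborel {- R..R} (\<lambda>x. cutoff R x * f x)"
    by (simp add: set_integrable_def trunc_def mult_ac)
  from set_borel_integral_eq_integral(2)[OF this]
  show "integral {- R..R} (\<lambda>x. cutoff R x * f x) = (LINT x|lborel. trunc R x * f x)"
    by (simp add: set_lebesgue_integral_def trunc_def mult_ac)
qed

lemma trunc_tendsto: "(\<lambda>n. trunc (real n) x) \<longlonglongrightarrow> 1"
proof -
  have "(\<lambda>n. cutoff (real n) x) \<longlonglongrightarrow> (1 - 0\<^sup>2)\<^sup>2"
    unfolding cutoff_def by (intro tendsto_intros lim_const_over_n)
  moreover have "\<forall>\<^sub>F n in sequentially. trunc (real n) x = cutoff (real n) x"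
    using eventually_ge_at_top[of "nat \<lceil>\<bar>x\<bar>\<rceil>"]
    by eventually_elim (auto simp: trunc_def indicator_def)
  ultimately show ?thesis by (simp add: tendsto_cong)
qed

lemma cutoff_integral_tendsto:
  fixes f :: "real \<Rightarrow> real"
  assumes f: "integrable lborel f"
  shows "(\<lambda>n. integral {- real n..real n} (\<lambda>x. cutoff (real n) x * f x)) \<longlonglongrightarrow> (LINT x|lborel. f x)"
proof -
  have [measurable]: "f \<in> borel_measurable borel" using f by auto
  have lim: "(\<lambda>n. LINT x|lborel. trunc (real (Suc n)) x * f x) \<longlonglongrightarrow> (LINT x|lborel. f x)"
  proof (rule integral_dominated_convergence[where w="\<lambda>x. \<bar>f x\<bar>"])
    show "AE x in lborel. (\<lambda>n. trunc (real (Suc n)) x * f x) \<longlonglongrightarrow> f x"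
      using tendsto_mult_right[OF LIMSEQ_Suc[OF trunc_tendsto]] by fastforce
    show "AE x in lborel. norm (trunc (real (Suc n)) x * f x) \<le> \<bar>f x\<bar>" for n
      using trunc_bounds[of "real (Suc n)"] by (auto simp: abs_mult intro!: mult_left_le_one_le)
  qed (use f in auto)
  have eq: "integral {- real (Suc n)..real (Suc n)} (\<lambda>x. cutoff (real (Suc n)) x * f x)
      = (LINT x|lborel. trunc (real (Suc n)) x * f x)" for n
    by (rule cutoff_integral_eq(2)[OF f]) simp
  show ?thesis by (rule LIMSEQ_imp_Suc) (simp only: eq lim)
qed

lemma integral_interval_le:
  fixes f :: "real \<Rightarrow> real"
  assumes f: "integrable lborel f" and "\<And>x. 0 \<le> f x"
  shows "integral {a..b} f \<le> (LINT x|lborel. f x)"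
proof -
  have "set_integrable lborel {a..b} f"
    unfolding set_integrable_def by (rule integrable_mult_indicator) (use f in auto)
  then have "integral {a..b} f = (LINT x:{a..b}|lborel. f x)" "set_integrable lborel {a..b} f"
    by (auto simp: set_borel_integral_eq_integral)
  then show ?thesis
    unfolding set_lebesgue_integral_def set_integrable_def
    using assms by (auto intro!: integral_mono split: split_indicator)
qed

lemma pdens1_integrable_growth:
  assumes p: "pdens1 p" and [measurable]: "g \<in> borel_measurable borel"
    and g: "\<And>x. \<bar>g x\<bar> \<le> C * (1 + \<bar>x\<bar>)"
  shows "integrable lborel (\<lambda>x. g x * p x)"
proof (rule Bochner_Integration.integrable_bound)
  have [measurable]: "p \<in> borel_measurable borel" using p by (auto simp: pdens1_def)
  show "integrable lborel (\<lambda>x. C * (p x + \<bar>x * p x\<bar>))"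
    using p by (auto simp: pdens1_def)
  show "(\<lambda>x. g x * p x) \<in> borel_measurable lborel" by measurable
  have "\<bar>g x * p x\<bar> \<le> C * (p x + \<bar>x * p x\<bar>)" for x
  proof -
    have "\<bar>g x\<bar> * p x \<le> C * (1 + \<bar>x\<bar>) * p x"
      using p g by (intro mult_right_mono) (auto simp: pdens1_def)
    then show ?thesis using p by (simp add: abs_mult pdens1_def algebra_simps)
  qed
  then show "AE x in lborel. norm (g x * p x) \<le> norm (C * (p x + \<bar>x * p x\<bar>))"
    by (auto intro: order_trans[OF _ abs_ge_self])
qed

lemma pdens1_integral_bound:
  assumes p: "pdens1 p" and [measurable]: "g \<in> borel_measurable borel" "k \<in> borel_measurable borel"
    and g: "\<And>x. \<bar>g x\<bar> \<le> k x" "\<And>x. k x \<le> C * (1 + \<bar>x\<bar>)"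
  shows "\<bar>LINT x|lborel. g x * p x\<bar> \<le> (LINT x|lborel. k x * p x)"
proof -
  have k0: "0 \<le> k x" for x using g(1)[of x] by linarith
  have I: "integrable lborel (\<lambda>x. k x * p x)" "integrable lborel (\<lambda>x. g x * p x)"
    by (rule pdens1_integrable_growth[OF p, where C=C]; (simp add: k0 g order_trans[OF g])?)+
  have "\<bar>LINT x|lborel. g x * p x\<bar> \<le> (LINT x|lborel. \<bar>g x * p x\<bar>)" by (rule integral_abs_bound)
  also have "\<dots> \<le> (LINT x|lborel. k x * p x)"
    using p I g integrable_abs[OF I(2)] by (intro integral_mono) (auto simp: abs_mult pdens1_def intro!: mult_right_mono)
  finally show ?thesis .
qed

text \<open>For large \<open>r\<close> this weight measures the tails of first moments, for small \<open>r\<close> it is a smoothing of the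
  absolute value.\<close>

definition tail :: "real \<Rightarrow> real \<Rightarrow> real" where
  "tail r x = sqrt (r\<^sup>2 + x\<^sup>2) - r"

definition tail' :: "real \<Rightarrow> real \<Rightarrow> real" where
  "tail' r x = x / sqrt (r\<^sup>2 + x\<^sup>2)"

definition tail'' :: "real \<Rightarrow> real \<Rightarrow> real" where
  "tail'' r x = r\<^sup>2 / ((r\<^sup>2 + x\<^sup>2) * sqrt (r\<^sup>2 + x\<^sup>2))"

lemma sqrt_bounds:
  fixes r x :: real
  assumes "r > 0"
  shows "r \<le> sqrt (r\<^sup>2 + x\<^sup>2)" "\<bar>x\<bar> \<le> sqrt (r\<^sup>2 + x\<^sup>2)" "sqrt (r\<^sup>2 + x\<^sup>2) \<le> r + \<bar>x\<bar>"
  using assms by (auto intro!: real_le_rsqrt real_le_lsqrt simp: power2_sum)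

lemma tail_derivs:
  assumes "r > 0"
  shows "(tail r has_real_derivative tail' r x) (at x)"
    and "(tail' r has_real_derivative tail'' r x) (at x)"
proof -
  let ?s = "sqrt (r\<^sup>2 + x\<^sup>2)"
  have pos: "0 < r\<^sup>2 + x\<^sup>2" "0 < ?s" using assms by (auto simp: add_pos_nonneg)
  have sq: "?s * ?s = r\<^sup>2 + x\<^sup>2" using pos by simp
  show "(tail r has_real_derivative tail' r x) (at x)"
    unfolding tail_def tail'_def using pos
    by (auto intro!: derivative_eq_intros simp: field_simps)
  have "((\<lambda>x. x / sqrt (r\<^sup>2 + x\<^sup>2)) has_real_derivative (?s - x * (x / ?s)) / (?s * ?s)) (at x)"
    using pos by (auto intro!: derivative_eq_intros simp: field_simps)
  also have "(?s - x * (x / ?s)) / (?s * ?s) = tail'' r x"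
  proof -
    have "?s - x * (x / ?s) = (?s * ?s - x\<^sup>2) / ?s"
      using pos by (simp add: diff_divide_distrib power2_eq_square del: real_sqrt_mult_self)
    also have "\<dots> = r\<^sup>2 / ?s" unfolding sq by simp
    finally have "?s - x * (x / ?s) = r\<^sup>2 / ?s" .
    then show ?thesis unfolding tail''_def sq by (simp add: mult.commute)
  qed
  finally show "(tail' r has_real_derivative tail'' r x) (at x)" unfolding tail'_def[abs_def] .
qed

lemma continuous_on_tail'': "r > 0 \<Longrightarrow> continuous_on S (tail'' r)"
proof -
  assume "r > 0"
  then have "r\<^sup>2 + x\<^sup>2 \<noteq> 0" for x by (simp add: sum_power2_eq_zero_iff)
  then show ?thesis unfolding tail''_def by (intro continuous_intros) auto
qed

lemma tail_bounds:
  assumes r: "r > 0"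
  shows "0 \<le> tail r x" "tail r x \<le> \<bar>x\<bar>" "\<bar>tail' r x\<bar> \<le> 1" "\<bar>tail' r x\<bar> \<le> \<bar>x\<bar> / r" "\<bar>tail'' r x\<bar> \<le> 1 / r"
proof -
  let ?s = "sqrt (r\<^sup>2 + x\<^sup>2)"
  note b = sqrt_bounds[OF r, of x]
  have s: "0 < ?s" using b r by linarith
  show "0 \<le> tail r x" "tail r x \<le> \<bar>x\<bar>" using b by (auto simp: tail_def)
  show "\<bar>tail' r x\<bar> \<le> 1" unfolding tail'_def using b s by (simp add: divide_le_eq)
  show "\<bar>tail' r x\<bar> \<le> \<bar>x\<bar> / r" unfolding tail'_def using b s r
    by (auto simp: intro!: divide_left_mono)
  have "r\<^sup>2 / ((r\<^sup>2 + x\<^sup>2) * ?s) = (r\<^sup>2 / (r\<^sup>2 + x\<^sup>2)) * (1 / ?s)" by simp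
  also have "\<dots> \<le> 1 * (1 / r)"
  proof (rule mult_mono)
    have "0 < r\<^sup>2 + x\<^sup>2" using s by simp
    then show "r\<^sup>2 / (r\<^sup>2 + x\<^sup>2) \<le> 1" by (simp add: divide_le_eq)
    show "1 / ?s \<le> 1 / r" using b s r by (auto intro!: divide_left_mono)
  qed (use s in auto)
  finally show "\<bar>tail'' r x\<bar> \<le> 1 / r" unfolding tail''_def using s by (simp add: abs_mult)
qed

lemma one_minus_trunc_le_tail:
  assumes R: "R \<ge> 1"
  shows "(1 - trunc R x) * (1 + \<bar>x\<bar>) \<le> 2 * \<bar>x\<bar> / R + 6 * tail R x"
proof -
  let ?s = "sqrt (R\<^sup>2 + x\<^sup>2)"
  have R0: "R > 0" using R by simp
  note b = sqrt_bounds[OF R0, of x]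
  have prod: "tail R x * (?s + R) = x\<^sup>2"
    unfolding tail_def by (simp add: algebra_simps power2_eq_square)
  show ?thesis
  proof (cases "x \<in> {- R..R}")
    case True
    then have x: "\<bar>x\<bar> \<le> R" by auto
    have "tail R x * (?s + R) \<le> tail R x * (3 * R)"
      using b x by (intro mult_left_mono[OF _ tail_bounds(1)[OF R0]]) linarith
    then have "x\<^sup>2 \<le> tail R x * (3 * R)" by (simp only: prod)
    then have t: "x\<^sup>2 / R \<le> 3 * tail R x" using R by (simp add: field_simps)
    have "x\<^sup>2 / R\<^sup>2 = (\<bar>x\<bar> / R) * (\<bar>x\<bar> / R)" by (simp add: power2_eq_square)
    also have "\<dots> \<le> (\<bar>x\<bar> / R) * 1" using x R by (intro mult_left_mono) auto
    finally have y: "x\<^sup>2 / R\<^sup>2 \<le> \<bar>x\<bar> / R" by simp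
    have "(1 - trunc R x) * (1 + \<bar>x\<bar>) \<le> 2 * (x\<^sup>2 / R\<^sup>2) * (1 + \<bar>x\<bar>)"
      using cutoff_bounds(5)[OF R True] True
      by (intro mult_right_mono) (auto simp: trunc_def power_divide)
    also have "\<dots> = 2 * (x\<^sup>2 / R\<^sup>2) + 2 * (x\<^sup>2 / R) * (\<bar>x\<bar> / R)"
      by (simp add: power2_eq_square algebra_simps add_divide_distrib)
    also have "\<dots> \<le> 2 * (\<bar>x\<bar> / R) + 2 * (x\<^sup>2 / R) * 1"
      using y x R by (intro add_mono mult_left_mono) auto
    also have "\<dots> \<le> 2 * \<bar>x\<bar> / R + 6 * tail R x" using t by simp
    finally show ?thesis .
  next
    case False
    then have x: "R < \<bar>x\<bar>" by auto
    have "tail R x * (?s + R) \<le> tail R x * (3 * \<bar>x\<bar>)"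
      using b x by (intro mult_left_mono[OF _ tail_bounds(1)[OF R0]]) linarith
    then have "\<bar>x\<bar> * \<bar>x\<bar> \<le> (3 * tail R x) * \<bar>x\<bar>"
      unfolding prod by (simp add: power2_eq_square)
    then have "\<bar>x\<bar> \<le> 3 * tail R x" using x R by (subst (asm) mult_le_cancel_right) auto
    moreover have "1 + \<bar>x\<bar> \<le> 2 * \<bar>x\<bar>" "0 \<le> 2 * \<bar>x\<bar> / R" using x R by auto
    ultimately show ?thesis using False by (simp add: trunc_def)
  qed
qed

lemma tail_integral_tendsto:
  assumes p: "pdens1 p"
  shows "(\<lambda>n. LINT x|lborel. tail (real n) x * p x) \<longlonglongrightarrow> 0"
proof -
  have [measurable]: "p \<in> borel_measurable borel" using p by (auto simp: pdens1_def)
  have tail0: "(\<lambda>n. tail (real (Suc n)) x) \<longlonglongrightarrow> 0" for x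
  proof (rule tendsto_sandwich[OF _ _ tendsto_const])
    show "\<forall>\<^sub>F n in sequentially. 0 \<le> tail (real (Suc n)) x"
      by (intro always_eventually allI tail_bounds) auto
    have "tail (real (Suc n)) x \<le> x\<^sup>2 / real (Suc n)" for n
    proof -
      let ?R = "real (Suc n)"
      have R: "0 < ?R" by simp
      have "tail ?R x * (sqrt (?R\<^sup>2 + x\<^sup>2) + ?R) = x\<^sup>2"
        unfolding tail_def by (simp add: algebra_simps power2_eq_square)
      moreover have "tail ?R x * ?R \<le> tail ?R x * (sqrt (?R\<^sup>2 + x\<^sup>2) + ?R)"
        using tail_bounds[OF R] by (intro mult_left_mono) auto
      ultimately show ?thesis by (simp add: pos_le_divide_eq)
    qed
    then show "\<forall>\<^sub>F n in sequentially. tail (real (Suc n)) x \<le> x\<^sup>2 / real (Suc n)" by simp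
    show "(\<lambda>n. x\<^sup>2 / real (Suc n)) \<longlonglongrightarrow> 0"
      by (rule LIMSEQ_Suc[OF lim_const_over_n])
  qed
  have lim: "(\<lambda>n. LINT x|lborel. tail (real (Suc n)) x * p x) \<longlonglongrightarrow> integral\<^sup>L lborel (\<lambda>x :: real. 0 :: real)"
  proof (rule integral_dominated_convergence[where w="\<lambda>x. \<bar>x * p x\<bar>" and f="\<lambda>_. 0"
        and s="\<lambda>n x. tail (real (Suc n)) x * p x"])
    show "AE x in lborel. (\<lambda>n. tail (real (Suc n)) x * p x) \<longlonglongrightarrow> 0"
      using tendsto_mult_left_zero[OF tail0] by fastforce
    show "AE x in lborel. norm (tail (real (Suc n)) x * p x) \<le> \<bar>x * p x\<bar>" for n
      using tail_bounds[of "real (Suc n)"] by (auto simp: abs_mult intro!: mult_right_mono)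
    show "(\<lambda>x. tail (real (Suc n)) x * p x) \<in> borel_measurable lborel" for n
      unfolding tail_def by measurable
  qed (use p in \<open>auto simp: pdens1_def\<close>)
  show ?thesis by (rule LIMSEQ_imp_Suc) (use lim in simp)
qed

section \<open>Densities with a bounded drift\<close>

lemma continuous_on_slice:
  assumes "continuous_on (S \<times> UNIV) (\<lambda>(t, x). f t x)" "t \<in> S"
  shows "continuous_on A (f t)"
proof -
  have "continuous_on A ((\<lambda>(t, x). f t x) \<circ> (\<lambda>x. (t, x)))"
    by (rule continuous_on_compose)
      (use assms in \<open>auto intro!: continuous_intros intro: continuous_on_subset\<close>)
  then show ?thesis by (simp add: o_def)
qed

lemma derivative_le_imp_increment_le:
  fixes f :: "real \<Rightarrow> real"
  assumes "s \<le> t" "continuous_on {s..t} f"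
    and "\<And>x. s < x \<Longrightarrow> x < t \<Longrightarrow> \<exists>D. (f has_real_derivative D) (at x) \<and> D \<le> K"
  shows "f t \<le> f s + K * (t - s)"
proof -
  have "(\<lambda>x. K * x - f x) s \<le> (\<lambda>x. K * x - f x) t"
  proof (rule DERIV_nonneg_imp_increasing_open[OF assms(1)])
    fix x assume "s < x" "x < t"
    then obtain D where "(f has_real_derivative D) (at x)" "D \<le> K" using assms(3) by blast
    then show "\<exists>y. ((\<lambda>x. K * x - f x) has_real_derivative y) (at x) \<and> 0 \<le> y"
      by (intro exI[of _ "K - D"]) (auto intro!: derivative_eq_intros)
  qed (intro continuous_intros assms)
  then show ?thesis by (simp add: algebra_simps)
qed

locale fokker_planck =
  fixes T a L :: real and m mt mx mxx h :: "real \<Rightarrow> real \<Rightarrow> real"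
  assumes T: "0 < T" and a: "0 \<le> a" and L: "0 \<le> L"
    and m_cont: "continuous_on ({0..T} \<times> UNIV) (\<lambda>(t, x). m t x)"
    and mt: "\<And>t x. t \<in> {0<..<T} \<Longrightarrow> ((\<lambda>s. m s x) has_real_derivative mt t x) (at t)"
    and mx: "\<And>t x. t \<in> {0<..<T} \<Longrightarrow> (m t has_real_derivative mx t x) (at x)"
    and mxx: "\<And>t x. t \<in> {0<..<T} \<Longrightarrow> (mx t has_real_derivative mxx t x) (at x)"
    and mt_cont: "continuous_on ({0<..<T} \<times> UNIV) (\<lambda>(t, x). mt t x)"
    and mxx_cont: "continuous_on ({0<..<T} \<times> UNIV) (\<lambda>(t, x). mxx t x)"
    and pdens: "\<And>t. t \<in> {0..T} \<Longrightarrow> pdens1 (m t)"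
    and flux_bound: "\<And>t x. t \<in> {0<..<T} \<Longrightarrow> \<bar>h t x\<bar> \<le> L * m t x"
    and flux_deriv: "\<And>t x. t \<in> {0<..<T} \<Longrightarrow> (h t has_real_derivative mt t x - a * mxx t x) (at x)"
begin

lemma nonneg: "t \<in> {0..T} \<Longrightarrow> 0 \<le> m t x"
  using pdens[of t] by (simp add: pdens1_def)

lemma m_slice: "t \<in> {0..T} \<Longrightarrow> continuous_on A (m t)"
  by (rule continuous_on_slice[OF m_cont])

lemma flux_slice: "t \<in> {0<..<T} \<Longrightarrow> continuous_on A (h t)"
  by (rule DERIV_continuous_on[OF has_field_derivative_at_within[OF flux_deriv]])

lemma continuous_on_cutoff_integral:
  assumes g: "continuous_on (S \<times> UNIV) (\<lambda>(t, x). g t x)" and S: "S \<subseteq> {0..T}" and R: "R \<noteq> 0"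
  shows "continuous_on S (\<lambda>t. integral {- R..R} (\<lambda>x. cutoff R x * g t x * m t x))"
proof -
  have "continuous_on (S \<times> cbox (- R) R) (\<lambda>(t, x). g t x)"
    "continuous_on (S \<times> cbox (- R) R) (\<lambda>(t, x). m t x)"
    using S by (auto intro: continuous_on_subset[OF g] continuous_on_subset[OF m_cont])
  then have "continuous_on (S \<times> cbox (- R) R) (\<lambda>(t, x). cutoff R x * g t x * m t x)"
    using R unfolding split_def by (intro continuous_intros) auto
  from integral_continuous_on_param[OF this] show ?thesis by simp
qed

text \<open>Test functions of linear growth are admissible up to an error of order \<open>1/R\<close>,
  and this needs no decay of the derivatives of the density.\<close>

lemma weak_formulation:
  assumes R: "R \<ge> 1" and t: "t \<in> {0<..<T}"
    and u_cont: "continuous_on ({0<..<T} \<times> UNIV) (\<lambda>(t, x). u t x)"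
    and ut: "\<And>t x. t \<in> {0<..<T} \<Longrightarrow> ((\<lambda>s. u s x) has_real_derivative ut t x) (at t)"
    and ut_cont: "continuous_on ({0<..<T} \<times> UNIV) (\<lambda>(t, x). ut t x)"
    and ux: "\<And>x. (u t has_real_derivative ux x) (at x)"
    and uxx: "\<And>x. (ux has_real_derivative uxx x) (at x)"
    and uxx_cont: "continuous_on UNIV uxx"
    and growth: "\<And>x. \<bar>u t x\<bar> \<le> C * (1 + \<bar>x\<bar>)" "\<And>x. \<bar>ux x\<bar> \<le> C * (1 + \<bar>x\<bar>)"
  shows "\<exists>D. ((\<lambda>t. integral {- R..R} (\<lambda>x. cutoff R x * u t x * m t x)) has_real_derivative D) (at t) \<and>
    \<bar>D - integral {- R..R} (\<lambda>x. cutoff R x * ((ut t x + a * uxx x) * m t x - h t x * ux x))\<bar>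
      \<le> (16 * a + 4 * L) * C / R * integral {- R..R} (\<lambda>x. (1 + \<bar>x\<bar>) * m t x)"
proof -
  have R0: "R \<noteq> 0" using R by auto
  have t0: "t \<in> {0..T}" using t by auto
  note slices = m_slice[OF t0] continuous_on_slice[OF u_cont t] continuous_on_slice[OF ut_cont t]
    continuous_on_slice[OF mt_cont t] continuous_on_slice[OF mxx_cont t] flux_slice[OF t]
  let ?I = "integral {- R..R}"
  let ?f = "\<lambda>x. cutoff R x * (ut t x * m t x)"
  let ?g = "\<lambda>x. cutoff R x * u t x * mt t x"
  let ?k = "\<lambda>x. cutoff R x * (a * uxx x * m t x - h t x * ux x)"
  have c: "continuous_on {- R..R} ux" "continuous_on {- R..R} uxx"
    by (rule DERIV_continuous_on[OF has_field_derivative_at_within[OF uxx]]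
        continuous_on_subset[OF uxx_cont subset_UNIV])+
  have "((\<lambda>s. integral (cbox (- R) R) (\<lambda>x. cutoff R x * u s x * m s x)) has_real_derivative
       integral (cbox (- R) R) (\<lambda>x. ?f x + ?g x)) (at t within {0<..<T})"
  proof (rule leibniz_rule_field_derivative
      [where fx="\<lambda>t x. cutoff R x * (ut t x * m t x) + cutoff R x * u t x * mt t x"])
    show "((\<lambda>s. cutoff R x * u s x * m s x) has_real_derivative
        cutoff R x * (ut s x * m s x) + cutoff R x * u s x * mt s x) (at s within {0<..<T})"
      if "s \<in> {0<..<T}" for s x
      by (rule derivative_eq_intros ut[OF that, THEN has_field_derivative_at_within]
            mt[OF that, THEN has_field_derivative_at_within] refl)+ (simp add: algebra_simps)
    show "(\<lambda>x. cutoff R x * u s x * m s x) integrable_on cbox (- R) R" if "s \<in> {0<..<T}" for s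
      using that R0
      by (intro integrable_continuous continuous_intros m_slice continuous_on_slice[OF u_cont that]) auto
    have cont: "continuous_on ({0<..<T} \<times> cbox (- R) R) (\<lambda>(t, x). ut t x)"
      "continuous_on ({0<..<T} \<times> cbox (- R) R) (\<lambda>(t, x). u t x)"
      "continuous_on ({0<..<T} \<times> cbox (- R) R) (\<lambda>(t, x). m t x)"
      "continuous_on ({0<..<T} \<times> cbox (- R) R) (\<lambda>(t, x). mt t x)"
      by (rule continuous_on_subset[OF ut_cont] continuous_on_subset[OF u_cont]
          continuous_on_subset[OF m_cont] continuous_on_subset[OF mt_cont]; force)+
    show "continuous_on ({0<..<T} \<times> cbox (- R) R)
        (\<lambda>(t, x). cutoff R x * (ut t x * m t x) + cutoff R x * u t x * mt t x)"
      using R0 cont unfolding split_def by (intro continuous_intros) auto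
  qed (use t in auto)
  then have D: "((\<lambda>s. ?I (\<lambda>x. cutoff R x * u s x * m s x)) has_real_derivative ?I (\<lambda>x. ?f x + ?g x)) (at t)"
    by (simp add: at_within_open[OF t open_greaterThanLessThan])
  have int: "?f integrable_on {- R..R}" "?g integrable_on {- R..R}" "?k integrable_on {- R..R}"
    using R0 c by (auto intro!: integrable_continuous_interval continuous_intros slices)
  have "\<bar>?I (\<lambda>x. cutoff R x * u t x * ((mt t x - a * mxx t x) + a * mxx t x)) - ?I ?k\<bar>
      \<le> (16 * a + 4 * L) * C / R * ?I (\<lambda>x. (1 + \<bar>x\<bar>) * m t x)"
    by (rule cutoff_by_parts[OF R a ux uxx mx[OF t] mxx[OF t] flux_deriv[OF t] uxx_cont _ _ _ flux_bound[OF t]])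
      (use growth nonneg[OF t0] in \<open>auto intro!: continuous_intros slices\<close>)
  then have *: "\<bar>?I ?g - ?I ?k\<bar> \<le> (16 * a + 4 * L) * C / R * ?I (\<lambda>x. (1 + \<bar>x\<bar>) * m t x)"
    by simp
  have "?I (\<lambda>x. ?f x + ?g x) = ?I ?f + ?I ?g" "?I (\<lambda>x. ?f x + ?k x) = ?I ?f + ?I ?k"
    using int by (simp_all add: integral_add)
  moreover have "(\<lambda>x. ?f x + ?k x) = (\<lambda>x. cutoff R x * ((ut t x + a * uxx x) * m t x - h t x * ux x))"
    by (simp add: algebra_simps)
  ultimately show ?thesis using D * by (intro exI[of _ "?I (\<lambda>x. ?f x + ?g x)"]) auto
qed

lemma integrable_growth:
  assumes "t \<in> {0..T}" "g \<in> borel_measurable borel" "\<And>x. \<bar>g x\<bar> \<le> C * (1 + \<bar>x\<bar>)"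
  shows "integrable lborel (\<lambda>x. g x * m t x)"
  using pdens1_integrable_growth[OF pdens] assms by blast

lemma integrable_moment: "t \<in> {0..T} \<Longrightarrow> integrable lborel (\<lambda>x. (1 + \<bar>x\<bar>) * m t x)"
  by (rule integrable_growth[where C=1]) auto

lemma integrable_tail:
  assumes "t \<in> {0..T}" "r > 0"
  shows "integrable lborel (\<lambda>x. tail r x * m t x)"
proof (rule integrable_growth[where C=1])
  show "tail r \<in> borel_measurable borel" unfolding tail_def by measurable
  show "\<bar>tail r x\<bar> \<le> 1 * (1 + \<bar>x\<bar>)" for x using tail_bounds(1,2)[OF assms(2), of x] by simp
qed (rule assms)

lemma interval_integral_moment_le:
  "t \<in> {0..T} \<Longrightarrow> integral {b..c} (\<lambda>x. (1 + \<bar>x\<bar>) * m t x) \<le> (LINT x|lborel. (1 + \<bar>x\<bar>) * m t x)"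
  by (rule integral_interval_le[OF integrable_moment]) (auto simp: nonneg)

lemma tail_evolution:
  assumes r: "r > 0" and t: "t \<in> {0..T}"
    and bound: "\<And>n t. 1 \<le> n \<Longrightarrow> t \<in> {0<..<T} \<Longrightarrow>
      integral {- n..n} (\<lambda>x. (a / r + L * \<bar>tail' r x\<bar>) * m t x)
       + (16 * a + 4 * L) / n * integral {- n..n} (\<lambda>x. (1 + \<bar>x\<bar>) * m t x) \<le> A + B / n"
  shows "(LINT x|lborel. tail r x * m t x) \<le> (LINT x|lborel. tail r x * m 0 x) + A * t"
proof -
  let ?B = "\<lambda>n t. integral {- n..n} (\<lambda>x. cutoff n x * tail r x * m t x)"
  have step: "?B n t \<le> ?B n 0 + (A + B / n) * (t - 0)" if n: "n \<ge> 1" for n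
  proof (rule derivative_le_imp_increment_le)
    show "continuous_on {0..t} (?B n)"
    proof (rule continuous_on_cutoff_integral)
      show "continuous_on ({0..t} \<times> UNIV) (\<lambda>(t, x). tail r x)"
        unfolding split_def tail_def by (intro continuous_intros)
    qed (use t n in auto)
    fix s assume "0 < s" "s < t"
    then have s: "s \<in> {0<..<T}" "s \<in> {0..T}" using t by auto
    have tc: "continuous_on (({0<..<T} :: real set) \<times> UNIV) (\<lambda>(t, x). tail r x)"
      unfolding split_def tail_def by (intro continuous_intros)
    have g: "\<bar>tail r x\<bar> \<le> 1 * (1 + \<bar>x\<bar>)" "\<bar>tail' r x\<bar> \<le> 1 * (1 + \<bar>x\<bar>)" for x
      using tail_bounds[OF r, of x] by auto
    obtain D where D: "(?B n has_real_derivative D) (at s)"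
      "\<bar>D - integral {- n..n} (\<lambda>x. cutoff n x * ((0 + a * tail'' r x) * m s x - h s x * tail' r x))\<bar>
        \<le> (16 * a + 4 * L) * 1 / n * integral {- n..n} (\<lambda>x. (1 + \<bar>x\<bar>) * m s x)"
      using weak_formulation[OF n s(1) tc, of "\<lambda>_ _. 0", OF _ _ tail_derivs[OF r] continuous_on_tail''[OF r] g]
      by (auto simp: split_def)
    note [continuous_intros] = continuous_on_tail''[OF r] m_slice[OF s(2)] flux_slice[OF s(1)]
      DERIV_continuous_on[OF has_field_derivative_at_within[OF tail_derivs(2)[OF r]]]
    have "integral {- n..n} (\<lambda>x. cutoff n x * ((0 + a * tail'' r x) * m s x - h s x * tail' r x))
       \<le> integral {- n..n} (\<lambda>x. (a / r + L * \<bar>tail' r x\<bar>) * m s x)"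
    proof (rule integral_le)
      fix x assume x: "x \<in> {- n..n}"
      have 1: "a * tail'' r x * m s x \<le> a * (1 / r) * m s x"
        using tail_bounds(5)[OF r, of x] a nonneg[OF s(2), of x]
        by (intro mult_right_mono mult_left_mono) auto
      have "\<bar>h s x * tail' r x\<bar> \<le> L * m s x * \<bar>tail' r x\<bar>"
        unfolding abs_mult using flux_bound[OF s(1)] by (intro mult_right_mono) auto
      then have 2: "(0 + a * tail'' r x) * m s x - h s x * tail' r x \<le> (a / r + L * \<bar>tail' r x\<bar>) * m s x"
        using 1 by (simp add: algebra_simps)
      have 3: "0 \<le> (a / r + L * \<bar>tail' r x\<bar>) * m s x"
        using a L r nonneg[OF s(2)] by auto
      have "cutoff n x * ((0 + a * tail'' r x) * m s x - h s x * tail' r x)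
          \<le> cutoff n x * ((a / r + L * \<bar>tail' r x\<bar>) * m s x)"
        using 2 cutoff_bounds(1)[OF n x] by (rule mult_left_mono)
      also have "\<dots> \<le> (a / r + L * \<bar>tail' r x\<bar>) * m s x"
        using 3 cutoff_bounds[OF n x] by (intro mult_left_le_one_le) auto
      finally show "cutoff n x * ((0 + a * tail'' r x) * m s x - h s x * tail' r x)
          \<le> (a / r + L * \<bar>tail' r x\<bar>) * m s x" .
    qed (use n r in \<open>auto intro!: integrable_continuous_interval continuous_intros\<close>)
    then show "\<exists>D. (?B n has_real_derivative D) (at s) \<and> D \<le> A + B / n"
      using D bound[OF n s(1)] by (intro exI[of _ D]) auto
  qed (use t in auto)
  have lim: "(\<lambda>n. ?B (real n) s) \<longlonglongrightarrow> (LINT x|lborel. tail r x * m s x)" if "s \<in> {0..T}" for s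
    using cutoff_integral_tendsto[OF integrable_tail[OF that r]] by (simp add: mult.assoc)
  have "(\<lambda>n. ?B (real n) 0 + (A + B / real n) * (t - 0)) \<longlonglongrightarrow> (LINT x|lborel. tail r x * m 0 x) + (A + 0) * (t - 0)"
    using T by (intro tendsto_intros lim lim_const_over_n) auto
  with lim[OF t] have "(LINT x|lborel. tail r x * m t x) \<le> (LINT x|lborel. tail r x * m 0 x) + (A + 0) * (t - 0)"
    by (rule LIMSEQ_le) (use step in \<open>auto intro!: exI[of _ 1]\<close>)
  then show ?thesis by simp
qed

lemma mass_le_1: "t \<in> {0..T} \<Longrightarrow> integral {b..c} (m t) \<le> 1"
  using integral_interval_le[of "m t" b c] pdens[of t] by (simp add: pdens1_def)

lemma moment_bounded: "\<exists>M\<ge>1. \<forall>t\<in>{0..T}. (LINT x|lborel. (1 + \<bar>x\<bar>) * m t x) \<le> M"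
proof -
  define K where "K = (a + L) + 2 * (16 * a + 4 * L)"
  define M where "M = 2 + (LINT x|lborel. tail 1 x * m 0 x) + K * T"
  have K: "K \<ge> 0" using a L by (simp add: K_def)
  have 1: "(LINT x|lborel. (1 + \<bar>x\<bar>) * m t x) \<le> M" if t: "t \<in> {0..T}" for t
  proof -
    have "(LINT x|lborel. tail 1 x * m t x) \<le> (LINT x|lborel. tail 1 x * m 0 x) + K * t"
    proof (rule tail_evolution[where B=0])
      fix n s :: real assume n: "1 \<le> n" and "s \<in> {0<..<T}"
      then have s: "s \<in> {0..T}" by auto
      note [continuous_intros] = m_slice[OF s]
        DERIV_continuous_on[OF has_field_derivative_at_within[OF tail_derivs(2)[of 1, OF zero_less_one]]]
      have "integral {- n..n} (\<lambda>x. (a / 1 + L * \<bar>tail' 1 x\<bar>) * m s x) \<le> integral {- n..n} (\<lambda>x. (a + L) * m s x)"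
        by (rule integral_le)
          (use L a nonneg[OF s] tail_bounds(3)[of 1, OF zero_less_one] in \<open>auto intro!: integrable_continuous_interval continuous_intros mult_right_mono mult_left_le\<close>)
      also have "\<dots> \<le> (a + L) * 1" using mass_le_1[OF s] a L
        unfolding integral_mult_right by (intro mult_left_mono) auto
      finally have A: "integral {- n..n} (\<lambda>x. (a / 1 + L * \<bar>tail' 1 x\<bar>) * m s x) \<le> a + L" by simp
      have "integral {- n..n} (\<lambda>x. (1 + \<bar>x\<bar>) * m s x) \<le> integral {- n..n} (\<lambda>x. (2 * n) * m s x)"
        by (rule integral_le)
          (use n nonneg[OF s] in \<open>auto intro!: integrable_continuous_interval continuous_intros mult_right_mono\<close>)
      also have "\<dots> \<le> (2 * n) * 1" using mass_le_1[OF s] n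
        unfolding integral_mult_right by (intro mult_left_mono) auto
      finally have "(16 * a + 4 * L) / n * integral {- n..n} (\<lambda>x. (1 + \<bar>x\<bar>) * m s x) \<le> (16 * a + 4 * L) / n * (2 * n)"
        using a L n by (intro mult_left_mono) auto
      then show "integral {- n..n} (\<lambda>x. (a / 1 + L * \<bar>tail' 1 x\<bar>) * m s x)
         + (16 * a + 4 * L) / n * integral {- n..n} (\<lambda>x. (1 + \<bar>x\<bar>) * m s x) \<le> K + 0 / n"
        using A n by (simp add: K_def)
    qed (use t in auto)
    also have "\<dots> \<le> (LINT x|lborel. tail 1 x * m 0 x) + K * T"
      using t K by (intro add_left_mono mult_left_mono) auto
    finally have tl: "(LINT x|lborel. tail 1 x * m t x) \<le> (LINT x|lborel. tail 1 x * m 0 x) + K * T" .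
    have p: "integrable lborel (m t)" "(LINT x|lborel. m t x) = 1" using pdens[OF t] by (auto simp: pdens1_def)
    have "(LINT x|lborel. (1 + \<bar>x\<bar>) * m t x) \<le> (LINT x|lborel. 2 * m t x + tail 1 x * m t x)"
    proof (rule integral_mono)
      fix x
      have "1 + \<bar>x\<bar> \<le> 2 + tail 1 x" using sqrt_bounds(2)[of 1 x] by (simp add: tail_def)
      from mult_right_mono[OF this nonneg[OF t]]
      show "(1 + \<bar>x\<bar>) * m t x \<le> 2 * m t x + tail 1 x * m t x" by (simp add: algebra_simps)
    qed (use p integrable_moment[OF t] integrable_tail[OF t, of 1] in auto)
    also have "\<dots> = 2 + (LINT x|lborel. tail 1 x * m t x)"
      using p integrable_tail[OF t, of 1] by simp
    finally show ?thesis using tl by (simp add: M_def)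
  qed
  moreover have "M \<ge> 1"
  proof -
    have "0 \<le> (LINT x|lborel. tail 1 x * m 0 x)"
      using T by (intro Bochner_Integration.integral_nonneg) (auto intro!: mult_nonneg_nonneg nonneg tail_bounds)
    moreover have "0 \<le> K * T" using K T by simp
    ultimately show ?thesis by (simp add: M_def)
  qed
  ultimately show ?thesis by blast
qed

lemma uniform_tail:
  "\<exists>\<epsilon>. \<epsilon> \<longlonglongrightarrow> 0 \<and> (\<forall>n\<ge>1. \<forall>t\<in>{0..T}.
     (LINT x|lborel. ((1 - trunc (real n) x) * (1 + \<bar>x\<bar>)) * m t x) \<le> \<epsilon> n)"
proof -
  obtain M where M: "M \<ge> 1" "\<And>t. t \<in> {0..T} \<Longrightarrow> (LINT x|lborel. (1 + \<bar>x\<bar>) * m t x) \<le> M"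
    using moment_bounded by blast
  define \<epsilon> where "\<epsilon> n = 2 * M / real n + 6 * ((LINT x|lborel. tail (real n) x * m 0 x) + (a + L) * M * T / real n)" for n
  have "\<epsilon> \<longlonglongrightarrow> 0 + 6 * (0 + 0)"
    unfolding \<epsilon>_def using T
    by (intro tendsto_intros lim_const_over_n tail_integral_tendsto pdens) auto
  moreover have "(LINT x|lborel. ((1 - trunc (real n) x) * (1 + \<bar>x\<bar>)) * m t x) \<le> \<epsilon> n"
    if "n \<ge> 1" and t: "t \<in> {0..T}" for n t
  proof -
    let ?r = "real n"
    have r1: "?r \<ge> 1" using that by simp
    then have r: "?r > 0" by simp
    have tl: "(LINT x|lborel. tail ?r x * m t x) \<le> (LINT x|lborel. tail ?r x * m 0 x) + ((a + L) / ?r * M) * t"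
    proof (rule tail_evolution[where B="(16 * a + 4 * L) * M"])
      fix n s :: real assume n: "1 \<le> n" and "s \<in> {0<..<T}"
      then have s: "s \<in> {0..T}" by auto
      note [continuous_intros] = m_slice[OF s]
        DERIV_continuous_on[OF has_field_derivative_at_within[OF tail_derivs(2)[OF r]]]
      have "integral {- n..n} (\<lambda>x. (a / ?r + L * \<bar>tail' ?r x\<bar>) * m s x)
          \<le> integral {- n..n} (\<lambda>x. (a + L) / ?r * ((1 + \<bar>x\<bar>) * m s x))"
      proof (rule integral_le)
        fix x
        have "a / ?r + L * \<bar>tail' ?r x\<bar> \<le> a / ?r + L * (\<bar>x\<bar> / ?r)"
          using tail_bounds(4)[OF r] L by (intro add_left_mono mult_left_mono) auto
        also have "\<dots> \<le> (a + L) / ?r * (1 + \<bar>x\<bar>)"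
          using r a L by (simp add: field_simps)
        finally show "(a / ?r + L * \<bar>tail' ?r x\<bar>) * m s x \<le> (a + L) / ?r * ((1 + \<bar>x\<bar>) * m s x)"
          using mult_right_mono[OF _ nonneg[OF s]] by (simp only: mult.assoc[symmetric])
      qed (use r in \<open>auto intro!: integrable_continuous_interval continuous_intros\<close>)
      also have "\<dots> \<le> (a + L) / ?r * M"
        using order_trans[OF interval_integral_moment_le[OF s] M(2)[OF s]] a L r
        by (simp only: integral_mult_right) (intro mult_left_mono, auto)
      finally have A: "integral {- n..n} (\<lambda>x. (a / ?r + L * \<bar>tail' ?r x\<bar>) * m s x) \<le> (a + L) / ?r * M" .
      have "(16 * a + 4 * L) / n * integral {- n..n} (\<lambda>x. (1 + \<bar>x\<bar>) * m s x) \<le> (16 * a + 4 * L) / n * M"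
        using order_trans[OF interval_integral_moment_le[OF s] M(2)[OF s]] a L n
        by (intro mult_left_mono) auto
      with A show "integral {- n..n} (\<lambda>x. (a / ?r + L * \<bar>tail' ?r x\<bar>) * m s x)
         + (16 * a + 4 * L) / n * integral {- n..n} (\<lambda>x. (1 + \<bar>x\<bar>) * m s x)
         \<le> (a + L) / ?r * M + (16 * a + 4 * L) * M / n" by simp
    qed (use t r in auto)
    have "((a + L) / ?r * M) * t \<le> ((a + L) / ?r * M) * T"
      using t a L M r by (intro mult_left_mono) auto
    then have tl2: "(LINT x|lborel. tail ?r x * m t x) \<le> (LINT x|lborel. tail ?r x * m 0 x) + (a + L) * M * T / ?r"
      using tl by simp
    let ?g = "\<lambda>x. (1 - trunc ?r x) * (1 + \<bar>x\<bar>)"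
    have g: "0 \<le> ?g x" "\<bar>?g x\<bar> \<le> 1 * (1 + \<bar>x\<bar>)" for x
      using trunc_bounds[OF r1, of x] by (auto simp: abs_mult intro!: mult_left_le_one_le)
    have "(LINT x|lborel. ?g x * m t x) \<le> (LINT x|lborel. 2 / ?r * ((1 + \<bar>x\<bar>) * m t x) + 6 * (tail ?r x * m t x))"
    proof (rule integral_mono)
      show "integrable lborel (\<lambda>x. ?g x * m t x)"
        by (rule integrable_growth[OF t _ g(2)]) measurable
      fix x
      have "?g x \<le> 2 * \<bar>x\<bar> / ?r + 6 * tail ?r x" by (rule one_minus_trunc_le_tail[OF r1])
      also have "\<dots> \<le> 2 / ?r * (1 + \<bar>x\<bar>) + 6 * tail ?r x" using r by (simp add: field_simps)
      finally show "?g x * m t x \<le> 2 / ?r * ((1 + \<bar>x\<bar>) * m t x) + 6 * (tail ?r x * m t x)"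
        using mult_right_mono[OF _ nonneg[OF t]]
        by (simp only: mult.assoc[symmetric] distrib_right[symmetric])
    qed (use integrable_moment[OF t] integrable_tail[OF t r] in auto)
    also have "\<dots> = 2 / ?r * (LINT x|lborel. (1 + \<bar>x\<bar>) * m t x) + 6 * (LINT x|lborel. tail ?r x * m t x)"
      using integrable_moment[OF t] integrable_tail[OF t r] by (subst Bochner_Integration.integral_add) auto
    also have "\<dots> \<le> 2 / ?r * M + 6 * ((LINT x|lborel. tail ?r x * m 0 x) + (a + L) * M * T / ?r)"
      using tl2 M(2)[OF t] r by (intro add_mono mult_left_mono) auto
    finally show ?thesis by (simp add: \<epsilon>_def)
  qed
  ultimately show ?thesis by (intro exI[of _ \<epsilon>]) auto
qed

lemma uniform_truncation:
  "\<exists>\<epsilon>. \<epsilon> \<longlonglongrightarrow> 0 \<and> (\<forall>n\<ge>1. \<forall>t\<in>{0..T}. \<forall>g C. g \<in> borel_measurable borel \<longrightarrow> (\<forall>x. \<bar>g x\<bar> \<le> C * (1 + \<bar>x\<bar>)) \<longrightarrow>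
     \<bar>(LINT x|lborel. g x * m t x) - integral {- real n..real n} (\<lambda>x. cutoff (real n) x * g x * m t x)\<bar> \<le> C * \<epsilon> n)"
proof -
  obtain \<epsilon> where \<epsilon>: "\<epsilon> \<longlonglongrightarrow> 0" "\<And>n t. n \<ge> 1 \<Longrightarrow> t \<in> {0..T} \<Longrightarrow>
     (LINT x|lborel. ((1 - trunc (real n) x) * (1 + \<bar>x\<bar>)) * m t x) \<le> \<epsilon> n"
    using uniform_tail by blast
  have "\<bar>(LINT x|lborel. g x * m t x) - integral {- real n..real n} (\<lambda>x. cutoff (real n) x * g x * m t x)\<bar> \<le> C * \<epsilon> n"
    if "n \<ge> 1" and t: "t \<in> {0..T}" and [measurable]: "g \<in> borel_measurable borel"
      and g: "\<And>x. \<bar>g x\<bar> \<le> C * (1 + \<bar>x\<bar>)" for n t g C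
  proof -
    have n: "real n \<ge> 1" using that by simp
    have C: "C \<ge> 0" using g[of 0] by simp
    note I = integrable_growth[OF t that(3) g]
    have "integral {- real n..real n} (\<lambda>x. cutoff (real n) x * g x * m t x) = (LINT x|lborel. trunc (real n) x * (g x * m t x))"
      using cutoff_integral_eq(2)[OF I n] by (simp add: mult.assoc)
    moreover have "(1 - trunc (real n) x) * g x * m t x = g x * m t x - trunc (real n) x * (g x * m t x)" for x
      by (simp add: algebra_simps)
    ultimately have "\<bar>(LINT x|lborel. g x * m t x) - integral {- real n..real n} (\<lambda>x. cutoff (real n) x * g x * m t x)\<bar>
       = \<bar>LINT x|lborel. ((1 - trunc (real n) x) * g x) * m t x\<bar>"
      using I cutoff_integral_eq(1)[OF I n]
      by (simp only: Bochner_Integration.integral_diff)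
    also have "\<dots> \<le> (LINT x|lborel. (C * ((1 - trunc (real n) x) * (1 + \<bar>x\<bar>))) * m t x)"
    proof (rule pdens1_integral_bound[OF pdens[OF t], where C=C])
      fix x
      have b: "0 \<le> 1 - trunc (real n) x" "1 - trunc (real n) x \<le> 1" using trunc_bounds[OF n, of x] by auto
      show "\<bar>(1 - trunc (real n) x) * g x\<bar> \<le> C * ((1 - trunc (real n) x) * (1 + \<bar>x\<bar>))"
        using mult_left_mono[OF g b(1), of x] b by (simp add: abs_mult mult_ac)
      show "C * ((1 - trunc (real n) x) * (1 + \<bar>x\<bar>)) \<le> C * (1 + \<bar>x\<bar>)"
        using C b by (intro mult_left_mono mult_left_le_one_le) auto
    qed measurable
    also have "\<dots> = C * (LINT x|lborel. ((1 - trunc (real n) x) * (1 + \<bar>x\<bar>)) * m t x)"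
      by (simp add: mult.assoc)
    also have "\<dots> \<le> C * \<epsilon> n" using \<epsilon>(2)[OF that(1) t] C by (rule mult_left_mono)
    finally show ?thesis .
  qed
  with \<epsilon>(1) show ?thesis by blast
qed

lemma continuous_on_expectation:
  assumes k: "continuous_on (S \<times> UNIV) (\<lambda>(t, x). k t x)" and S: "S \<subseteq> {0..T}"
    and growth: "\<And>t x. t \<in> S \<Longrightarrow> \<bar>k t x\<bar> \<le> C * (1 + \<bar>x\<bar>)"
  shows "continuous_on S (\<lambda>t. LINT x|lborel. k t x * m t x)"
proof -
  obtain \<epsilon> where \<epsilon>: "\<epsilon> \<longlonglongrightarrow> 0" and app: "\<And>n t g C. n \<ge> 1 \<Longrightarrow> t \<in> {0..T} \<Longrightarrow> g \<in> borel_measurable borel \<Longrightarrow>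
     (\<forall>x. \<bar>g x\<bar> \<le> C * (1 + \<bar>x\<bar>)) \<Longrightarrow>
     \<bar>(LINT x|lborel. g x * m t x) - integral {- real n..real n} (\<lambda>x. cutoff (real n) x * g x * m t x)\<bar> \<le> C * \<epsilon> n"
    using uniform_truncation by blast
  let ?I = "\<lambda>n t. integral {- real n..real n} (\<lambda>x. cutoff (real n) x * k t x * m t x)"
  have ul: "uniform_limit S ?I (\<lambda>t. LINT x|lborel. k t x * m t x) sequentially"
  proof (rule uniform_limitI)
    fix e :: real assume e: "0 < e"
    have "(\<lambda>n. C * \<epsilon> n) \<longlonglongrightarrow> C * 0" by (intro tendsto_intros \<epsilon>)
    then have "\<forall>\<^sub>F n in sequentially. C * \<epsilon> n < e" using e by (auto dest: order_tendstoD(2))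
    then show "\<forall>\<^sub>F n in sequentially. \<forall>t\<in>S. dist (?I n t) (LINT x|lborel. k t x * m t x) < e"
      using eventually_ge_at_top[of 1]
    proof eventually_elim
      case (elim n)
      show ?case
      proof
        fix t assume t: "t \<in> S"
        have "k t \<in> borel_measurable borel"
          by (rule borel_measurable_continuous_onI[OF continuous_on_slice[OF k t]])
        then have "\<bar>(LINT x|lborel. k t x * m t x) - ?I n t\<bar> \<le> C * \<epsilon> n"
          using S t elim growth[OF t] by (intro app) auto
        then show "dist (?I n t) (LINT x|lborel. k t x * m t x) < e"
          using elim by (simp add: dist_real_def)
      qed
    qed
  qed
  show ?thesis
  proof (rule uniform_limit_theorem[OF _ ul])
    show "\<forall>\<^sub>F n in sequentially. continuous_on S (?I n)"
      using eventually_ge_at_top[of 1]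
      by eventually_elim (auto intro!: continuous_on_cutoff_integral[OF k S])
  qed simp
qed

end

section \<open>Uniqueness for the decoupled equations\<close>

lemma second_derivative_nonpos_at_max:
  fixes f f' :: "real \<Rightarrow> real"
  assumes f: "\<And>x. (f has_real_derivative f' x) (at x)" and f': "(f' has_real_derivative D) (at y)"
    and max: "\<And>x. f x \<le> f y"
  shows "f' y = 0" "D \<le> 0"
proof -
  show 0: "f' y = 0" by (rule DERIV_local_max[OF f, of 1]) (use max in auto)
  show "D \<le> 0"
  proof (rule ccontr)
    assume "\<not> D \<le> 0"
    then obtain d where d: "d > 0" "\<And>h. 0 < h \<Longrightarrow> h < d \<Longrightarrow> f' y < f' (y + h)"
      using DERIV_pos_inc_right[OF f'] by auto
    have "f y < f (y + d / 2)"
    proof (rule DERIV_pos_imp_increasing_open[of y "y + d / 2" f])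
      fix x assume "y < x" "x < y + d / 2"
      then have "f' y < f' (y + (x - y))" using d(1) by (intro d(2)) auto
      then show "\<exists>z. (f has_real_derivative z) (at x) \<and> 0 < z" using f[of x] 0 by auto
    qed (use d f in \<open>auto intro: DERIV_continuous_on has_field_derivative_at_within\<close>)
    with max[of "y + d / 2"] show False by simp
  qed
qed

lemma parabolic_comparison:
  fixes w wt wx wxx :: "real \<Rightarrow> real \<Rightarrow> real"
  assumes a: "0 \<le> a" and L: "0 \<le> L"
    and cont: "continuous_on ({0..T} \<times> UNIV) (\<lambda>(t, x). w t x)"
    and wt: "\<And>t x. t \<in> {0<..<T} \<Longrightarrow> ((\<lambda>s. w s x) has_real_derivative wt t x) (at t)"
    and wx: "\<And>t x. t \<in> {0<..<T} \<Longrightarrow> (w t has_real_derivative wx t x) (at x)"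
    and wxx: "\<And>t x. t \<in> {0<..<T} \<Longrightarrow> (wx t has_real_derivative wxx t x) (at x)"
    and sub: "\<And>t x. t \<in> {0<..<T} \<Longrightarrow> - L * \<bar>wx t x\<bar> \<le> wt t x + a * wxx t x"
    and growth: "\<And>t x. t \<in> {0..T} \<Longrightarrow> w t x \<le> C * (1 + \<bar>x\<bar>)"
    and terminal: "\<And>x. w T x \<le> 0"
    and t0: "t0 \<in> {0<..<T}"
  shows "w t0 x0 \<le> 0"
proof -
  define K where "K = 2 * a + L + 1"
  define c where "c = exp (K * (T - t0)) * (1 + x0\<^sup>2)"
  have c: "c > 0" by (simp add: c_def add_pos_nonneg)
  have main: "w t0 x0 \<le> e * c" if e: "e > 0" for e
  proof (rule ccontr)
    assume contra: "\<not> w t0 x0 \<le> e * c"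
    define \<phi> where "\<phi> t x = e * exp (K * (T - t)) * (1 + x\<^sup>2)" for t x :: real
    define g where "g t x = w t x - \<phi> t x" for t x
    define C' where "C' = max C 0"
    define B where "B = 1 + \<bar>x0\<bar> + 2 * C' / e"
    have K: "K > 0" using a L by (simp add: K_def)
    have \<phi>_ge: "e * (1 + x\<^sup>2) \<le> \<phi> t x" if "t \<le> T" for t x
    proof -
      have "1 \<le> exp (K * (T - t))" using K that by simp
      then have "e * 1 * (1 + x\<^sup>2) \<le> \<phi> t x"
        unfolding \<phi>_def using e by (intro mult_right_mono mult_left_mono) auto
      then show ?thesis by simp
    qed
    have far: "g t x \<le> 0" if t: "t \<in> {0..T}" and x: "\<bar>x\<bar> \<ge> B" for t x
    proof -
      have x1: "\<bar>x\<bar> \<ge> 1" and x2: "2 * C' / e \<le> \<bar>x\<bar>"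
        using x e by (auto simp: B_def C'_def intro: order_trans[rotated])
      have "w t x \<le> C' * (1 + \<bar>x\<bar>)"
        using growth[OF t, of x] mult_right_mono[of C C' "1 + \<bar>x\<bar>"] by (auto simp: C'_def)
      also have "\<dots> \<le> C' * (2 * \<bar>x\<bar>)"
        using x1 by (intro mult_left_mono) (auto simp: C'_def)
      also have "\<dots> = e * ((2 * C' / e) * \<bar>x\<bar>)" using e by simp
      also have "\<dots> \<le> e * (\<bar>x\<bar> * \<bar>x\<bar>)"
        using x2 e by (intro mult_left_mono mult_right_mono) auto
      also have "\<dots> \<le> e * (1 + x\<^sup>2)"
        using e by (simp add: power2_eq_square)
      also have "\<dots> \<le> \<phi> t x" using t by (intro \<phi>_ge) auto
      finally show ?thesis by (simp add: g_def)
    qed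
    let ?S = "{t0..T} \<times> {- B..B}"
    have B: "\<bar>x0\<bar> \<le> B" using e by (auto simp: B_def C'_def)
    have "\<exists>z\<in>?S. \<forall>z'\<in>?S. (\<lambda>(t, x). g t x) z' \<le> (\<lambda>(t, x). g t x) z"
    proof (rule continuous_attains_sup)
      show "compact ?S" by (intro compact_Times compact_Icc)
      show "?S \<noteq> {}" using t0 B by (auto simp: abs_le_iff)
      have "continuous_on ?S (\<lambda>(t, x). w t x)"
        using t0 by (intro continuous_on_subset[OF cont]) auto
      then show "continuous_on ?S (\<lambda>(t, x). g t x)"
        unfolding g_def \<phi>_def split_def by (intro continuous_intros)
    qed
    then obtain s y where s: "s \<in> {t0..T}" and y: "y \<in> {- B..B}"
      and max: "\<And>t x. t \<in> {t0..T} \<Longrightarrow> x \<in> {- B..B} \<Longrightarrow> g t x \<le> g s y"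
      by auto
    have "g t0 x0 > 0" using contra by (simp add: g_def \<phi>_def c_def mult.assoc)
    moreover have "g t0 x0 \<le> g s y" using t0 B by (intro max) (auto simp: abs_le_iff)
    ultimately have pos: "g s y > 0" by simp
    have "s \<noteq> T"
    proof
      assume "s = T"
      moreover have "0 \<le> \<phi> T y" using e by (simp add: \<phi>_def)
      ultimately show False using pos terminal[of y] by (simp add: g_def)
    qed
    then have s': "s \<in> {0<..<T}" using s t0 by auto
    have maxx: "g s x \<le> g s y" for x
    proof (cases "x \<in> {- B..B}")
      case False
      then have "g s x \<le> 0" using s' by (intro far) auto
      then show ?thesis using pos by simp
    qed (use s max in auto)
    have gx: "(g s has_real_derivative wx s x - e * exp (K * (T - s)) * (2 * x)) (at x)" for x
      unfolding g_def \<phi>_def by (rule derivative_eq_intros wx[OF s'] refl | simp)+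
    have gxx: "((\<lambda>x. wx s x - e * exp (K * (T - s)) * (2 * x)) has_real_derivative
        wxx s y - e * exp (K * (T - s)) * 2) (at y)"
      by (rule derivative_eq_intros wxx[OF s'] refl | simp)+
    have gt: "((\<lambda>t. g t y) has_real_derivative wt s y + K * \<phi> s y) (at s)"
      unfolding g_def \<phi>_def by (rule derivative_eq_intros wt[OF s'] refl | simp)+
    note 1 = second_derivative_nonpos_at_max[OF gx gxx maxx]
    have 2: "wt s y + K * \<phi> s y \<le> 0"
    proof (rule ccontr)
      assume "\<not> ?thesis"
      then obtain d where d: "d > 0" "\<And>h. 0 < h \<Longrightarrow> h < d \<Longrightarrow> g s y < g (s + h) y"
        using DERIV_pos_inc_right[OF gt] by auto
      define k where "k = min (d / 2) ((T - s) / 2)"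
      have k: "0 < k" "k < d" "s + k \<in> {t0..T}" using d(1) s s' by (auto simp: k_def min_def field_simps)
      show False using d(2)[OF k(1,2)] max[OF k(3) y] by simp
    qed
    define q where "q = e * exp (K * (T - s))"
    have q: "q > 0" using e by (simp add: q_def)
    have "wx s y = q * (2 * y)" using 1(1) by (simp add: q_def)
    then have "\<bar>wx s y\<bar> = q * (2 * \<bar>y\<bar>)" using q by (simp add: abs_mult)
    moreover have "a * wxx s y \<le> a * (q * 2)"
      using 1(2) a by (intro mult_left_mono) (auto simp: q_def)
    ultimately have "- L * (q * (2 * \<bar>y\<bar>)) \<le> - K * (q * (1 + y\<^sup>2)) + a * (q * 2)"
      using sub[OF s', of y] 2 by (simp add: \<phi>_def q_def)
    then have "q * (K * (1 + y\<^sup>2)) \<le> q * (a * 2 + L * (2 * \<bar>y\<bar>))" by (simp add: algebra_simps)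
    then have k1: "K * (1 + y\<^sup>2) \<le> a * 2 + L * (2 * \<bar>y\<bar>)" using q by (simp only: mult_le_cancel_left_pos)
    have "2 * \<bar>y\<bar> \<le> 1 + y\<^sup>2" using zero_le_power2[of "\<bar>y\<bar> - 1"] by (simp add: power2_diff)
    then have "L * (2 * \<bar>y\<bar>) \<le> L * (1 + y\<^sup>2)" using L by (rule mult_left_mono)
    moreover have "a * 2 \<le> a * 2 * (1 + y\<^sup>2)" using a by (simp add: algebra_simps)
    ultimately have "K * (1 + y\<^sup>2) \<le> (K - 1) * (1 + y\<^sup>2)" using k1 by (simp add: K_def algebra_simps)
    moreover have "0 < 1 + y\<^sup>2" by (simp add: add_pos_nonneg)
    ultimately show False by (simp only: mult_le_cancel_right_pos)
  qed
  show ?thesis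
  proof (rule field_le_epsilon)
    fix d :: real assume "d > 0"
    then show "w t0 x0 \<le> 0 + d" using main[of "d / c"] c by simp
  qed
qed

lemma tail''_mult_square_le:
  assumes "e > 0"
  shows "0 \<le> tail'' e y" "tail'' e y * y\<^sup>2 \<le> e"
proof -
  let ?s = "sqrt (e\<^sup>2 + y\<^sup>2)"
  have s: "e \<le> ?s" "0 < ?s" "0 < e\<^sup>2 + y\<^sup>2"
    using sqrt_bounds[OF assms, of y] assms by (auto simp: add_pos_nonneg)
  show "0 \<le> tail'' e y" using s by (simp add: tail''_def)
  have "tail'' e y * y\<^sup>2 = (e * (e / ?s)) * (y\<^sup>2 / (e\<^sup>2 + y\<^sup>2))"
    by (simp add: tail''_def power2_eq_square)
  also have "\<dots> \<le> (e * 1) * 1"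
    using s assms by (intro mult_mono mult_left_mono) (auto simp: divide_le_eq)
  finally show "tail'' e y * y\<^sup>2 \<le> e" by simp
qed

text \<open>Kato's inequality: the evolution of a smoothed \<open>L\<^sup>1\<close> norm only sees the flux through the cutoff.\<close>

lemma kato_uniqueness:
  fixes n nt nx nxx h :: "real \<Rightarrow> real \<Rightarrow> real"
  assumes T: "0 < T" and a: "0 < a" and L: "0 \<le> L"
    and cont: "continuous_on ({0..T} \<times> UNIV) (\<lambda>(t, x). n t x)"
    and nt: "\<And>t x. t \<in> {0<..<T} \<Longrightarrow> ((\<lambda>s. n s x) has_real_derivative nt t x) (at t)"
    and nx: "\<And>t x. t \<in> {0<..<T} \<Longrightarrow> (n t has_real_derivative nx t x) (at x)"
    and nxx: "\<And>t x. t \<in> {0<..<T} \<Longrightarrow> (nx t has_real_derivative nxx t x) (at x)"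
    and nt_cont: "continuous_on ({0<..<T} \<times> UNIV) (\<lambda>(t, x). nt t x)"
    and flux_bound: "\<And>t x. t \<in> {0<..<T} \<Longrightarrow> \<bar>h t x\<bar> \<le> L * \<bar>n t x\<bar>"
    and flux_deriv: "\<And>t x. t \<in> {0<..<T} \<Longrightarrow> (h t has_real_derivative nt t x - a * nxx t x) (at x)"
    and initial: "\<And>x. n 0 x = 0"
    and mass: "\<And>t R. t \<in> {0..T} \<Longrightarrow> integral {- R..R} (\<lambda>x. \<bar>n t x\<bar>) \<le> M"
    and t: "t \<in> {0..T}"
  shows "n t x = 0"
proof -
  define K where "K = (4 * L + 8 * a) * M + L\<^sup>2 / (2 * a)"
  note slice = continuous_on_slice[OF cont]
  have tc [continuous_intros]: "continuous_on S (\<lambda>z. tail e (f z))" "continuous_on S (\<lambda>z. tail' e (f z))"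
      "continuous_on S (\<lambda>z. tail'' e (f z))"
    if "e > 0" "continuous_on S f" for e S and f :: "'z::topological_space \<Rightarrow> real"
  proof -
    have "e\<^sup>2 + x\<^sup>2 \<noteq> 0" for x using that by (simp add: sum_power2_eq_zero_iff)
    then show "continuous_on S (\<lambda>z. tail e (f z))" "continuous_on S (\<lambda>z. tail' e (f z))"
      "continuous_on S (\<lambda>z. tail'' e (f z))"
      unfolding tail_def tail'_def tail''_def using that by (auto intro!: continuous_intros)
  qed
  have energy: "integral {- R..R} (\<lambda>x. cutoff R x * tail (1 / R\<^sup>2) (n t x)) \<le> K * T / R" if R: "R \<ge> 1" for R
  proof -
    define e where "e = 1 / R\<^sup>2"
    have e: "e > 0" and R0: "R \<noteq> 0" using R by (auto simp: e_def)
    let ?E = "\<lambda>t. integral {- R..R} (\<lambda>x. cutoff R x * tail e (n t x))"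
    have "?E t \<le> ?E 0 + K / R * (t - 0)"
    proof (rule derivative_le_imp_increment_le)
      have "continuous_on ({0..t} \<times> cbox (- R) R) (\<lambda>(t, x). n t x)"
        by (rule continuous_on_subset[OF cont]) (use t in auto)
      then have "continuous_on ({0..t} \<times> cbox (- R) R) (\<lambda>(t, x). cutoff R x * tail e (n t x))"
        unfolding split_def using R0 e by (intro continuous_intros)
      from integral_continuous_on_param[OF this]
      show "continuous_on {0..t} ?E" by simp
      fix s assume "0 < s" "s < t"
      then have s: "s \<in> {0<..<T}" and s0: "s \<in> {0..T}" using t by auto
      let ?k = "\<lambda>x. cutoff R x * (tail' e (n s x) * nt s x)"
      have "((\<lambda>t. integral (cbox (- R) R) (\<lambda>x. cutoff R x * tail e (n t x))) has_real_derivative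
          integral (cbox (- R) R) ?k) (at s within {0<..<T})"
      proof (rule leibniz_rule_field_derivative[where fx="\<lambda>s x. cutoff R x * (tail' e (n s x) * nt s x)"])
        show "((\<lambda>t. cutoff R x * tail e (n t x)) has_real_derivative
            cutoff R x * (tail' e (n s x) * nt s x)) (at s within {0<..<T})"
          if "s \<in> {0<..<T}" for s x
          using DERIV_cmult[OF DERIV_chain2[OF tail_derivs(1)[OF e] nt[OF that]]]
          by (rule has_field_derivative_at_within)
        show "(\<lambda>x. cutoff R x * tail e (n s x)) integrable_on cbox (- R) R" if "s \<in> {0<..<T}" for s
          by (intro integrable_continuous continuous_intros R0 e slice) (use that in auto)
        have "continuous_on ({0<..<T} \<times> cbox (- R) R) (\<lambda>(t, x). n t x)"
            "continuous_on ({0<..<T} \<times> cbox (- R) R) (\<lambda>(t, x). nt t x)"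
          by (rule continuous_on_subset[OF cont] continuous_on_subset[OF nt_cont]; force)+
        then show "continuous_on ({0<..<T} \<times> cbox (- R) R) (\<lambda>(s, x). cutoff R x * (tail' e (n s x) * nt s x))"
          unfolding split_def using R0 e by (intro continuous_intros)
      qed (use s in auto)
      then have D: "(?E has_real_derivative integral {- R..R} ?k) (at s)"
        by (simp add: at_within_open[OF s open_greaterThanLessThan])
      let ?g = "\<lambda>x. cutoff' R x * tail' e (n s x) * h s x
         + cutoff R x * (tail'' e (n s x) * (nx s x * (h s x + a * nx s x))) - a * cutoff'' R x * tail e (n s x)"
      define Q where "Q x = cutoff R x * (tail' e (n s x) * (h s x + a * nx s x)) - a * cutoff' R x * tail e (n s x)" for x
      have tn: "((\<lambda>x. tail e (n s x)) has_real_derivative tail' e (n s x) * nx s x) (at x)"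
         "((\<lambda>x. tail' e (n s x)) has_real_derivative tail'' e (n s x) * nx s x) (at x)" for x
        by (rule DERIV_chain2[OF tail_derivs(1)[OF e] nx[OF s]] DERIV_chain2[OF tail_derivs(2)[OF e] nx[OF s]])+
      have "(Q has_real_derivative ?k x + ?g x) (at x)" for x
        unfolding Q_def
        by (rule derivative_eq_intros cutoff_derivs[OF R0] tn nx[OF s] nxx[OF s] flux_deriv[OF s] refl)+
          (simp add: algebra_simps)
      then have "((\<lambda>x. ?k x + ?g x) has_integral Q R - Q (- R)) {- R..R}"
        using R by (intro fundamental_theorem_of_calculus)
          (auto simp: has_real_derivative_iff_has_vector_derivative[symmetric] intro: has_field_derivative_at_within)
      moreover have "Q R - Q (- R) = 0" using R0 by (simp add: Q_def)
      ultimately have I: "((\<lambda>x. ?k x + ?g x) has_integral 0) {- R..R}" by simp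
      have cs: "continuous_on {- R..R} (n s)" "continuous_on {- R..R} (nt s)" "continuous_on {- R..R} (nx s)"
          "continuous_on {- R..R} (h s)"
        by (rule slice[OF s0] continuous_on_slice[OF nt_cont s]
            DERIV_continuous_on[OF has_field_derivative_at_within[OF nxx[OF s]]]
            DERIV_continuous_on[OF has_field_derivative_at_within[OF flux_deriv[OF s]]])+
      have int: "?k integrable_on {- R..R}" "?g integrable_on {- R..R}"
        by (intro integrable_continuous_interval continuous_intros R0 e cs)+
      have "integral {- R..R} ?k = - integral {- R..R} ?g"
        using integral_add[OF int] I by (simp add: has_integral_iff)
      also have "\<dots> = integral {- R..R} (\<lambda>x. - ?g x)" by (rule integral_neg[symmetric])
      also have "\<dots> \<le> integral {- R..R} (\<lambda>x. (4 * L + 8 * a) / R * \<bar>n s x\<bar> + e * L\<^sup>2 / (4 * a))"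
      proof (rule integral_le)
        show "(\<lambda>x. - ?g x) integrable_on {- R..R}" using int(2) by (rule integrable_neg)
        show "(\<lambda>x. (4 * L + 8 * a) / R * \<bar>n s x\<bar> + e * L\<^sup>2 / (4 * a)) integrable_on {- R..R}"
          using R0 a by (intro integrable_continuous_interval continuous_intros cs)
        fix x assume x: "x \<in> {- R..R}"
        note b = cutoff_bounds[OF R x]
        let ?y = "n s x"
        have "\<bar>cutoff' R x\<bar> * \<bar>tail' e ?y\<bar> * \<bar>h s x\<bar> \<le> 4 / R * 1 * (L * \<bar>?y\<bar>)"
          using b(3) tail_bounds(3)[OF e] flux_bound[OF s] R by (intro mult_mono) auto
        then have 1: "- (cutoff' R x * tail' e ?y * h s x) \<le> 4 * L / R * \<bar>?y\<bar>"
          by (simp add: abs_mult[symmetric] abs_le_iff)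
        have "\<bar>a\<bar> * \<bar>cutoff'' R x\<bar> * \<bar>tail e ?y\<bar> \<le> a * (8 / R) * \<bar>?y\<bar>"
          using b(4) tail_bounds(1,2)[OF e, of ?y] a R by (intro mult_mono) auto
        then have 2: "a * cutoff'' R x * tail e ?y \<le> a * (8 / R) * \<bar>?y\<bar>"
          by (simp only: abs_mult[symmetric] abs_le_iff)
        have "(h s x)\<^sup>2 \<le> (L * \<bar>?y\<bar>)\<^sup>2"
          using flux_bound[OF s, of x] by (intro abs_le_square_iff[THEN iffD1]) auto
        then have "tail'' e ?y * (h s x)\<^sup>2 \<le> tail'' e ?y * (L\<^sup>2 * ?y\<^sup>2)"
          using tail''_mult_square_le(1)[OF e] by (intro mult_left_mono) (auto simp: power_mult_distrib)
        also have "\<dots> = L\<^sup>2 * (tail'' e ?y * ?y\<^sup>2)" by simp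
        also have "\<dots> \<le> L\<^sup>2 * e" using tail''_mult_square_le(2)[OF e] by (intro mult_left_mono) auto
        finally have 3: "tail'' e ?y * (h s x)\<^sup>2 \<le> L\<^sup>2 * e" .
        have "0 \<le> (h s x + 2 * a * nx s x)\<^sup>2 / (4 * a)" using a by simp
        also have "\<dots> = (h s x)\<^sup>2 / (4 * a) + nx s x * (h s x + a * nx s x)"
          using a by (simp add: field_simps power2_eq_square)
        finally have "tail'' e ?y * (- (nx s x * (h s x + a * nx s x))) \<le> tail'' e ?y * ((h s x)\<^sup>2 / (4 * a))"
          using tail''_mult_square_le(1)[OF e] by (intro mult_left_mono) auto
        also have "\<dots> \<le> e * L\<^sup>2 / (4 * a)"
          using 3 a by (simp add: divide_right_mono mult.commute)
        finally have "cutoff R x * (tail'' e ?y * (- (nx s x * (h s x + a * nx s x)))) \<le> cutoff R x * (e * L\<^sup>2 / (4 * a))"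
          using b(1) by (rule mult_left_mono)
        also have "\<dots> \<le> e * L\<^sup>2 / (4 * a)"
          using b(1,2) a e by (intro mult_left_le_one_le) auto
        finally have 4: "- (cutoff R x * (tail'' e ?y * (nx s x * (h s x + a * nx s x)))) \<le> e * L\<^sup>2 / (4 * a)"
          by simp
        have "(4 * L + 8 * a) / R * \<bar>?y\<bar> = 4 * L / R * \<bar>?y\<bar> + a * (8 / R) * \<bar>?y\<bar>"
          by (simp add: add_divide_distrib distrib_right)
        with 1 2 4 show "- ?g x \<le> (4 * L + 8 * a) / R * \<bar>?y\<bar> + e * L\<^sup>2 / (4 * a)" by linarith
      qed
      also have "\<dots> = (4 * L + 8 * a) / R * integral {- R..R} (\<lambda>x. \<bar>n s x\<bar>) + 2 * R * (e * L\<^sup>2 / (4 * a))"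
      proof (subst integral_add)
        show "(\<lambda>x. (4 * L + 8 * a) / R * \<bar>n s x\<bar>) integrable_on {- R..R}"
          using R0 by (intro integrable_continuous_interval continuous_intros cs)
      qed (use R in \<open>auto simp: integral_mult_right\<close>)
      also have "\<dots> \<le> (4 * L + 8 * a) / R * M + 2 * R * (e * L\<^sup>2 / (4 * a))"
        using mass[OF s0, of R] a L R by (intro add_right_mono mult_left_mono) auto
      also have "\<dots> = K / R"
        using R0 a by (simp add: K_def e_def field_simps power2_eq_square)
      finally show "\<exists>D. (?E has_real_derivative D) (at s) \<and> D \<le> K / R" using D by blast
    qed (use t in auto)
    also have "?E 0 = 0" using e by (simp add: initial tail_def)
    also have "0 + K / R * (t - 0) \<le> K / R * T"
    proof -
      have "0 \<le> M" using mass[OF t, of 0] by simp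
      then have "0 \<le> K" using a L by (simp add: K_def)
      then show ?thesis using t R by (auto intro!: mult_left_mono divide_right_mono)
    qed
    finally show ?thesis by (simp add: e_def)
  qed
  define r where "r = \<bar>x\<bar> + 1"
  have r: "r \<ge> 1" by (simp add: r_def)
  have "integral {- r..r} (\<lambda>x. \<bar>n t x\<bar>) \<le> 2 * (K * T / R) + 4 * r / R\<^sup>2" if R: "R \<ge> 2 * r" for R
  proof -
    let ?e = "1 / R\<^sup>2"
    have R1: "R \<ge> 1" and R0: "R \<noteq> 0" and sub: "{- r..r} \<subseteq> {- R..R}" and e: "?e > 0" using R r by auto
    note cs = slice[OF t]
    have int: "(\<lambda>x. cutoff R x * tail ?e (n t x)) integrable_on {b..c}" for b c
      by (intro integrable_continuous_interval continuous_intros R0 e cs)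
    have "integral {- r..r} (\<lambda>x. \<bar>n t x\<bar>) \<le> integral {- r..r} (\<lambda>x. 2 * (cutoff R x * tail ?e (n t x)) + 2 * ?e)"
    proof (rule integral_le)
      show "(\<lambda>x. \<bar>n t x\<bar>) integrable_on {- r..r}" "(\<lambda>x. 2 * (cutoff R x * tail ?e (n t x)) + 2 * ?e) integrable_on {- r..r}"
        by (intro integrable_continuous_interval continuous_intros R0 e cs; simp add: R0)+
      fix y assume y: "y \<in> {- r..r}"
      have "\<bar>y / R\<bar> \<le> 1 / 2" using y R r by (auto simp: abs_le_iff field_simps)
      then have "\<bar>y / R\<bar>\<^sup>2 \<le> (1 / 2)\<^sup>2" by (intro power_mono) auto
      then have "(y / R)\<^sup>2 \<le> 1 / 4" by (simp add: power2_eq_square)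
      then have "1 / 2 \<le> cutoff R y" using cutoff_bounds(5)[OF R1, of y] y sub by auto
      then have "1 / 2 * tail ?e (n t y) \<le> cutoff R y * tail ?e (n t y)"
        using tail_bounds(1)[OF e] by (rule mult_right_mono)
      moreover have "\<bar>n t y\<bar> \<le> tail ?e (n t y) + ?e"
        using sqrt_bounds(2)[OF e, of "n t y"] by (simp add: tail_def)
      moreover have "?e \<ge> 0" by simp
      ultimately show "\<bar>n t y\<bar> \<le> 2 * (cutoff R y * tail ?e (n t y)) + 2 * ?e" by linarith
    qed
    also have "\<dots> = 2 * integral {- r..r} (\<lambda>x. cutoff R x * tail ?e (n t x)) + 4 * r / R\<^sup>2"
      using int r by (subst integral_add) (auto simp: integral_mult_right)
    also have "integral {- r..r} (\<lambda>x. cutoff R x * tail ?e (n t x)) \<le> integral {- R..R} (\<lambda>x. cutoff R x * tail ?e (n t x))"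
      by (rule integral_subset_le[OF sub int int])
        (auto intro!: mult_nonneg_nonneg tail_bounds(1)[OF e] cutoff_bounds(1)[OF R1])
    also have "\<dots> \<le> K * T / R" by (rule energy[OF R1])
    finally show ?thesis by simp
  qed
  then have "\<forall>\<^sub>F R in at_top. integral {- r..r} (\<lambda>x. \<bar>n t x\<bar>) \<le> 2 * (K * T / R) + 4 * r / R\<^sup>2"
    using eventually_ge_at_top by (rule eventually_mono[rotated])
  moreover have "((\<lambda>R. 2 * (K * T / R) + 4 * r / R\<^sup>2) \<longlongrightarrow> 2 * 0 + 0) at_top"
    by (intro tendsto_intros tendsto_divide_0[OF tendsto_const] filterlim_at_top_imp_at_infinity filterlim_ident filterlim_pow_at_top) auto
  ultimately have "integral {- r..r} (\<lambda>x. \<bar>n t x\<bar>) \<le> 2 * 0 + 0"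
    by (intro tendsto_lowerbound) auto
  moreover have "0 \<le> integral {- r..r} (\<lambda>x. \<bar>n t x\<bar>)"
    by (intro integral_nonneg integrable_continuous_interval continuous_intros slice[OF t]) auto
  ultimately have "integral {- r..r} (\<lambda>x. \<bar>n t x\<bar>) = 0" by simp
  then have "\<forall>y\<in>{- r..r}. \<bar>n t y\<bar> = 0"
    using r by (subst (asm) integral_eq_0_iff) (auto intro!: continuous_intros slice[OF t])
  moreover have "x \<in> {- r..r}" by (auto simp: r_def)
  ultimately show ?thesis by auto
qed

lemma (in fokker_planck) weak_inequality:
  assumes u_cont: "continuous_on ({0<..<T} \<times> UNIV) (\<lambda>(t, x). u t x)"
    and ut: "\<And>t x. t \<in> {0<..<T} \<Longrightarrow> ((\<lambda>s. u s x) has_real_derivative ut t x) (at t)"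
    and ut_cont: "continuous_on ({0<..<T} \<times> UNIV) (\<lambda>(t, x). ut t x)"
    and ux: "\<And>t x. t \<in> {0<..<T} \<Longrightarrow> (u t has_real_derivative ux t x) (at x)"
    and uxx: "\<And>t x. t \<in> {0<..<T} \<Longrightarrow> (ux t has_real_derivative uxx t x) (at x)"
    and uxx_cont: "continuous_on ({0<..<T} \<times> UNIV) (\<lambda>(t, x). uxx t x)"
    and growth: "\<And>t x. t \<in> {0<..<T} \<Longrightarrow> \<bar>u t x\<bar> \<le> C * (1 + \<bar>x\<bar>)"
      "\<And>t x. t \<in> {0<..<T} \<Longrightarrow> \<bar>ux t x\<bar> \<le> C * (1 + \<bar>x\<bar>)"
    and f_cont: "\<And>t. t \<in> {0<..<T} \<Longrightarrow> continuous_on UNIV (f t)"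
    and f_growth: "\<And>t x. t \<in> {0<..<T} \<Longrightarrow> \<bar>f t x\<bar> \<le> C * (1 + \<bar>x\<bar>)"
    and dual: "\<And>t x. t \<in> {0<..<T} \<Longrightarrow> (ut t x + a * uxx t x) * m t x - h t x * ux t x \<le> - f t x * m t x"
  shows "\<exists>\<kappa>. \<kappa> \<longlonglongrightarrow> 0 \<and> (\<forall>n\<ge>1. \<forall>t\<in>{0<..<T}. \<exists>D.
    ((\<lambda>t. integral {- real n..real n} (\<lambda>x. cutoff (real n) x * u t x * m t x)) has_real_derivative D) (at t) \<and>
    D \<le> - (LINT x|lborel. f t x * m t x) + \<kappa> n)"
proof -
  obtain M where M: "\<And>t. t \<in> {0..T} \<Longrightarrow> (LINT x|lborel. (1 + \<bar>x\<bar>) * m t x) \<le> M"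
    using moment_bounded by blast
  obtain \<epsilon> where \<epsilon>: "\<epsilon> \<longlonglongrightarrow> 0" and app: "\<And>n t g C. n \<ge> 1 \<Longrightarrow> t \<in> {0..T} \<Longrightarrow> g \<in> borel_measurable borel \<Longrightarrow>
     (\<forall>x. \<bar>g x\<bar> \<le> C * (1 + \<bar>x\<bar>)) \<Longrightarrow>
     \<bar>(LINT x|lborel. g x * m t x) - integral {- real n..real n} (\<lambda>x. cutoff (real n) x * g x * m t x)\<bar> \<le> C * \<epsilon> n"
    using uniform_truncation by blast
  define \<kappa> where "\<kappa> n = (16 * a + 4 * L) * C * M / real n + C * \<epsilon> n" for n
  have "\<kappa> \<longlonglongrightarrow> 0 + C * 0"
    unfolding \<kappa>_def by (intro tendsto_intros \<epsilon> lim_const_over_n)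
  moreover have "\<exists>D. ((\<lambda>t. integral {- real n..real n} (\<lambda>x. cutoff (real n) x * u t x * m t x)) has_real_derivative D) (at t)
      \<and> D \<le> - (LINT x|lborel. f t x * m t x) + \<kappa> n" if n: "n \<ge> 1" and t: "t \<in> {0<..<T}" for n t
  proof -
    have R: "real n \<ge> 1" and R0: "real n \<noteq> 0" using n by auto
    have t0: "t \<in> {0..T}" using t by auto
    have C: "C \<ge> 0" using growth(1)[OF t, of 0] by simp
    obtain D where D: "((\<lambda>t. integral {- real n..real n} (\<lambda>x. cutoff (real n) x * u t x * m t x)) has_real_derivative D) (at t)"
      "\<bar>D - integral {- real n..real n} (\<lambda>x. cutoff (real n) x * ((ut t x + a * uxx t x) * m t x - h t x * ux t x))\<bar>
      \<le> (16 * a + 4 * L) * C / real n * integral {- real n..real n} (\<lambda>x. (1 + \<bar>x\<bar>) * m t x)"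
      using weak_formulation[OF R t u_cont ut ut_cont ux[OF t] uxx[OF t]
          continuous_on_slice[OF uxx_cont t] growth[OF t]] by blast
    have "(16 * a + 4 * L) * C / real n * integral {- real n..real n} (\<lambda>x. (1 + \<bar>x\<bar>) * m t x)
        \<le> (16 * a + 4 * L) * C / real n * M"
      using order_trans[OF interval_integral_moment_le[OF t0] M[OF t0]] a L C
      by (intro mult_left_mono) auto
    moreover have "integral {- real n..real n} (\<lambda>x. cutoff (real n) x * ((ut t x + a * uxx t x) * m t x - h t x * ux t x))
        \<le> integral {- real n..real n} (\<lambda>x. - (cutoff (real n) x * f t x * m t x))"
    proof (rule integral_le)
      have c: "continuous_on {- real n..real n} (f t)" "continuous_on {- real n..real n} (ux t)"
        by (rule continuous_on_subset[OF f_cont[OF t] subset_UNIV]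
            DERIV_continuous_on[OF has_field_derivative_at_within[OF uxx[OF t]]])+
      note cs = c continuous_on_slice[OF uxx_cont t] continuous_on_slice[OF ut_cont t] m_slice[OF t0] flux_slice[OF t]
      show "(\<lambda>x. cutoff (real n) x * ((ut t x + a * uxx t x) * m t x - h t x * ux t x)) integrable_on {- real n..real n}"
        "(\<lambda>x. - (cutoff (real n) x * f t x * m t x)) integrable_on {- real n..real n}"
        by (intro integrable_continuous_interval continuous_intros R0 cs)+
      fix x assume "x \<in> {- real n..real n}"
      from mult_left_mono[OF dual[OF t] cutoff_bounds(1)[OF R this], of x]
      show "cutoff (real n) x * ((ut t x + a * uxx t x) * m t x - h t x * ux t x) \<le> - (cutoff (real n) x * f t x * m t x)"
        by (simp add: mult.assoc)
    qed
    moreover have "\<bar>(LINT x|lborel. f t x * m t x) - integral {- real n..real n} (\<lambda>x. cutoff (real n) x * f t x * m t x)\<bar> \<le> C * \<epsilon> n"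
      using f_growth[OF t] by (intro app[OF n t0] borel_measurable_continuous_onI f_cont[OF t]) auto
    ultimately have "D \<le> - (LINT x|lborel. f t x * m t x) + \<kappa> n"
      using D(2) by (simp add: \<kappa>_def)
    with D(1) show ?thesis by blast
  qed
  ultimately show ?thesis by (intro exI[of _ \<kappa>]) auto
qed

lemma vanishing_dissipation:
  fixes A :: "nat \<Rightarrow> real \<Rightarrow> real"
  assumes cont: "\<And>n. n \<ge> 1 \<Longrightarrow> continuous_on {0..T} (A n)"
    and deriv: "\<And>n t. n \<ge> 1 \<Longrightarrow> t \<in> {0<..<T} \<Longrightarrow> \<exists>D. (A n has_real_derivative D) (at t) \<and> D \<le> - l t + \<kappa> n"
    and \<kappa>: "\<kappa> \<longlonglongrightarrow> 0"
    and l: "\<And>t. t \<in> {0<..<T} \<Longrightarrow> 0 \<le> l t" "continuous_on {0<..<T} l"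
    and A0: "\<And>n. A n 0 = 0" and AT: "(\<lambda>n. A n T) \<longlonglongrightarrow> s" "0 \<le> s"
    and t: "t \<in> {0<..<T}"
  shows "l t = 0"
proof (rule ccontr)
  assume "l t \<noteq> 0"
  then have pos: "l t > 0" using l(1)[OF t] by simp
  define \<delta> where "\<delta> = l t / 2"
  have "isCont l t" using l(2) t by (simp add: continuous_on_eq_continuous_at)
  then have "\<forall>\<^sub>F x in nhds t. \<delta> < l x"
    using pos by (intro order_tendstoD(1)[where y="l t"]) (auto simp: \<delta>_def continuous_at tendsto_nhds_iff)
  then obtain d where d: "d > 0" "\<And>x. dist x t < d \<Longrightarrow> \<delta> < l x"
    by (auto simp: eventually_nhds_metric)
  define r where "r = t + min (d / 2) ((T - t) / 2)"
  have r': "t < r" "r < T" "r < t + d"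
    using d(1) t by (auto simp: r_def min_def field_simps)
  then have r: "t < r" "r < T" "\<And>x. t < x \<Longrightarrow> x < r \<Longrightarrow> \<delta> < l x"
    by (auto simp: dist_real_def intro!: d(2))
  have "A n T \<le> \<kappa> n * T - \<delta> * (r - t)" if n: "n \<ge> 1" for n
  proof -
    have *: "A n y \<le> A n x + K * (y - x)"
      if xy: "0 \<le> x" "x \<le> y" "y \<le> T" and K: "\<And>z. x < z \<Longrightarrow> z < y \<Longrightarrow> - l z + \<kappa> n \<le> K" for x y K
    proof (rule derivative_le_imp_increment_le[OF xy(2)])
      show "continuous_on {x..y} (A n)" using xy by (intro continuous_on_subset[OF cont[OF n]]) auto
      fix z assume z: "x < z" "z < y"
      then show "\<exists>D. (A n has_real_derivative D) (at z) \<and> D \<le> K"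
        using deriv[OF n, of z] K[OF z] xy by force
    qed
    have "A n t \<le> A n 0 + \<kappa> n * (t - 0)" using t l(1) by (intro *) auto
    moreover have "A n r \<le> A n t + (\<kappa> n - \<delta>) * (r - t)" using t r by (intro *) (auto simp: less_imp_le)
    moreover have "A n T \<le> A n r + \<kappa> n * (T - r)" using t r l(1) by (intro *) auto
    ultimately show ?thesis by (simp add: A0 algebra_simps)
  qed
  moreover have "(\<lambda>n. \<kappa> n * T - \<delta> * (r - t)) \<longlonglongrightarrow> 0 * T - \<delta> * (r - t)"
    by (intro tendsto_intros \<kappa>)
  ultimately have "s \<le> 0 * T - \<delta> * (r - t)"
    by (intro LIMSEQ_le[OF AT(1)]) auto
  moreover have "\<delta> * (r - t) > 0" using pos r by (simp add: \<delta>_def)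
  ultimately show False using AT(2) by simp
qed

lemma lipschitz_deriv_bound:
  fixes f :: "real \<Rightarrow> real"
  assumes "L-lipschitz_on UNIV f" "f differentiable (at x)"
  shows "\<bar>deriv f x\<bar> \<le> L"
proof -
  have "(\<lambda>h. (f (x + h) - f x) / h) \<midarrow>0\<rightarrow> deriv f x"
    using assms(2) by (simp add: DERIV_deriv_iff_real_differentiable[symmetric] DERIV_def)
  then have lim: "(\<lambda>h. \<bar>(f (x + h) - f x) / h\<bar>) \<midarrow>0\<rightarrow> \<bar>deriv f x\<bar>" by (rule tendsto_rabs)
  have "\<bar>(f (x + h) - f x) / h\<bar> \<le> L" if "h \<noteq> 0" for h
    using lipschitz_onD[OF assms(1), of "x + h" x] that by (simp add: dist_real_def divide_le_eq)
  then have "\<forall>\<^sub>F h in at 0. \<bar>(f (x + h) - f x) / h\<bar> \<le> L"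
    by (auto simp: eventually_at_filter)
  with lim show ?thesis by (rule tendsto_upperbound) simp
qed

lemma integral_dens:
  assumes "pdens1 p" "g \<in> borel_measurable borel"
  shows "integral\<^sup>L (dens p) g = (LINT x|lborel. g x * p x)"
  using assms unfolding dens_def pdens1_def
  by (subst integral_real_density) (auto simp: mult.commute)

lemma Mean_dens: "pdens1 p \<Longrightarrow> Mean (dens p) = (LINT x|lborel. x * p x)"
  unfolding Mean_def by (rule integral_dens) auto

lemma dens_in_P1:
  assumes p: "pdens1 p"
  shows "dens p \<in> P1"
proof -
  have [measurable]: "p \<in> borel_measurable borel" using p by (simp add: pdens1_def)
  have "emeasure (dens p) (space (dens p)) = (\<integral>\<^sup>+x. ennreal (p x) \<partial>lborel)"
    by (simp add: dens_def emeasure_density)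
  also have "\<dots> = 1" using p by (subst nn_integral_eq_integral) (auto simp: pdens1_def)
  finally have "prob_space (dens p)" by (rule prob_spaceI)
  moreover have "integrable (dens p) (\<lambda>x. x)"
    using p unfolding dens_def
    by (subst integrable_real_density) (auto simp: pdens1_def mult.commute)
  ultimately show ?thesis by (simp add: P1_def dens_def)
qed

lemma lborel_integral_shift:
  fixes p g :: "real \<Rightarrow> real"
  shows "(LINT x|lborel. g x * p (x - d)) = (LINT x|lborel. g (x + d) * p x)"
  by (subst lborel_integral_real_affine[where c=1 and t=d]) (auto simp: add.commute)

lemma pdens1_shift:
  assumes p: "pdens1 p"
  shows "pdens1 (\<lambda>x. p (x - d))"
proof -
  have [measurable]: "p \<in> borel_measurable borel" using p by (simp add: pdens1_def)
  have "integrable lborel (\<lambda>x. p (- d + 1 * x))"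
    using p by (intro lborel_integrable_real_affine) (auto simp: pdens1_def)
  moreover have "integrable lborel (\<lambda>x. (- d + 1 * x) * p (- d + 1 * x))"
    using p by (intro lborel_integrable_real_affine[where f="\<lambda>x. x * p x"]) (auto simp: pdens1_def)
  ultimately have I: "integrable lborel (\<lambda>x. p (x - d))" "integrable lborel (\<lambda>x. (x - d) * p (x - d))"
    by simp_all
  have "integrable lborel (\<lambda>x. (x - d) * p (x - d) + d * p (x - d))"
    by (rule Bochner_Integration.integrable_add[OF I(2) integrable_mult_right[OF I(1)]])
  moreover have "(\<lambda>x. (x - d) * p (x - d) + d * p (x - d)) = (\<lambda>x. x * p (x - d))"
    by (simp add: algebra_simps)
  moreover have "(LINT x|lborel. p (x - d)) = 1"
    using lborel_integral_shift[of "\<lambda>_. 1" p d] p by (simp add: pdens1_def)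
  ultimately show ?thesis using p I by (auto simp: pdens1_def)
qed

lemma Mean_dens_shift:
  assumes p: "pdens1 p"
  shows "Mean (dens (\<lambda>x. p (x - d))) = Mean (dens p) + d"
  using p lborel_integral_shift[of "\<lambda>x. x" p d] unfolding Mean_dens[OF p] Mean_dens[OF pdens1_shift[OF p]]
  by (simp add: pdens1_def distrib_right)

lemma C2funI:
  assumes f: "\<And>x. (f has_real_derivative f' x) (at x)" "\<And>x. (f' has_real_derivative f'' x) (at x)"
    and "continuous_on UNIV f''"
  shows "C2fun f"
proof -
  have "deriv f = f'" "deriv f' = f''" using f by (auto intro: DERIV_imp_deriv)
  then show ?thesis using assms unfolding C2fun_def real_differentiable_def by auto
qed

lemma C12_derivs:
  assumes "C12 T f" "t \<in> {0<..<T}"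
  shows "((\<lambda>s. f s x) has_real_derivative dt f t x) (at t)"
    "(f t has_real_derivative dx f t x) (at x)"
    "(dx f t has_real_derivative dxx f t x) (at x)"
  using assms unfolding C12_def dt_def dxx_def
  by (auto simp: DERIV_deriv_iff_real_differentiable dx_def[abs_def])

lemma C12_shift_C2fun:
  assumes "C12 T f" "t \<in> {0<..<T}"
  shows "C2fun (\<lambda>x. f t (x - d))"
proof (rule C2funI)
  note D = C12_derivs[OF assms]
  have s: "((\<lambda>x. x - d) has_real_derivative 1) (at x)" for x by (auto intro!: derivative_eq_intros)
  show "((\<lambda>x. f t (x - d)) has_real_derivative dx f t (x - d)) (at x)"
    "((\<lambda>x. dx f t (x - d)) has_real_derivative dxx f t (x - d)) (at x)" for x
    using DERIV_chain2[OF D(2) s] DERIV_chain2[OF D(3) s] by simp_all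
  have "continuous_on UNIV (dxx f t)"
    using assms unfolding C12_def by (blast intro: continuous_on_slice)
  then show "continuous_on UNIV (\<lambda>x. dxx f t (x - d))"
    by (rule continuous_on_compose2) (auto intro!: continuous_intros)
qed

lemma MFG_solution_fokker_planck:
  assumes sol: "MFG_solution T H \<sigma> F G \<nu> v m" and i: "i \<in> {1, 2}" and T: "T > 0"
    and lip: "L-lipschitz_on UNIV (H i)"
  shows "fokker_planck T ((\<sigma> i)\<^sup>2 / 2) L (m i) (dt (m i)) (dx (m i)) (dxx (m i))
    (\<lambda>t x. deriv (H i) (dx (v i) t x) * m i t x)"
proof -
  have C12: "C12 T (m i)" and pd: "\<And>t. t \<in> {0..T} \<Longrightarrow> pdens1 (m i t)"
    and eq: "\<And>t x. t \<in> {0<..<T} \<Longrightarrow> H i differentiable (at (dx (v i) t x)) \<and>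
        (\<lambda>y. deriv (H i) (dx (v i) t y) * m i t y) differentiable (at x) \<and>
        dt (m i) t x - deriv (\<lambda>y. deriv (H i) (dx (v i) t y) * m i t y) x = (\<sigma> i)\<^sup>2 / 2 * dxx (m i) t x"
    using sol i unfolding MFG_solution_def by blast+
  show ?thesis
  proof
    show "0 \<le> L" using lip by (rule lipschitz_on_nonneg)
    show "continuous_on ({0..T} \<times> UNIV) (\<lambda>(t, x). m i t x)"
      "continuous_on ({0<..<T} \<times> UNIV) (\<lambda>(t, x). dt (m i) t x)"
      "continuous_on ({0<..<T} \<times> UNIV) (\<lambda>(t, x). dxx (m i) t x)"
      using C12 unfolding C12_def by blast+
    fix t x assume t: "t \<in> {0<..<T}"
    show "\<bar>deriv (H i) (dx (v i) t x) * m i t x\<bar> \<le> L * m i t x"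
      using lipschitz_deriv_bound[OF lip] eq[OF t] pd[of t] t
      by (auto simp: abs_mult pdens1_def intro!: mult_right_mono)
    show "((\<lambda>x. deriv (H i) (dx (v i) t x) * m i t x) has_real_derivative
        dt (m i) t x - (\<sigma> i)\<^sup>2 / 2 * dxx (m i) t x) (at x)"
    proof -
      have "deriv (\<lambda>y. deriv (H i) (dx (v i) t y) * m i t y) x = dt (m i) t x - (\<sigma> i)\<^sup>2 / 2 * dxx (m i) t x"
        using eq[OF t, of x] by linarith
      with eq[OF t, of x] show ?thesis by (metis DERIV_deriv_iff_real_differentiable)
    qed
  qed (use T C12_derivs[OF C12] pd in auto)
qed

section \<open>Two solutions of the mean field game system\<close>

lemma LL_sum_dens:
  assumes p: "pdens1 p1" "pdens1 p2" "pdens1 q1" "pdens1 q2"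
    and f: "f 1 \<in> borel_measurable borel" "f 2 \<in> borel_measurable borel"
    and eq: "\<And>x. \<Phi> 1 x (dens p1) (dens p2) - \<Phi> 1 x (dens q1) (dens q2) = f 1 x"
      "\<And>x. \<Phi> 2 x (dens p1) (dens p2) - \<Phi> 2 x (dens q1) (dens q2) = f 2 x"
  shows "LL_sum lam \<Phi> (dens p1) (dens p2) (dens q1) (dens q2) =
    lam 1 * ((LINT x|lborel. f 1 x * p1 x) - (LINT x|lborel. f 1 x * q1 x)) +
    lam 2 * ((LINT x|lborel. f 2 x * p2 x) - (LINT x|lborel. f 2 x * q2 x))"
  unfolding LL_sum_def eq by (simp add: integral_dens p f)

lemma depends_on_means_dens:
  assumes "depends_on_means \<Phi>" "pdens1 p1" "pdens1 p2" "pdens1 q1" "pdens1 q2"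
    and "Mean (dens p1) = Mean (dens q1)" "Mean (dens p2) = Mean (dens q2)"
  shows "\<Phi> x (dens p1) (dens p2) = \<Phi> x (dens q1) (dens q2)"
  using assms dens_in_P1 unfolding depends_on_means_def by blast

locale mfg_pair =
  fixes H :: "nat \<Rightarrow> real \<Rightarrow> real" and \<sigma> lam :: "nat \<Rightarrow> real"
    and \<nu> :: "nat \<Rightarrow> real \<Rightarrow> real"
    and F G :: "nat \<Rightarrow> real \<Rightarrow> real measure \<Rightarrow> real measure \<Rightarrow> real"
    and T :: real
    and v m v' m' :: "nat \<Rightarrow> real \<Rightarrow> real \<Rightarrow> real"
  assumes T: "T > 0"
    and H: "\<And>i. i \<in> {1, 2} \<Longrightarrow> convex_on UNIV (H i) \<and> (\<exists>L. L-lipschitz_on UNIV (H i))"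
    and \<sigma>: "\<And>i. i \<in> {1, 2} \<Longrightarrow> \<sigma> i > 0"
    and F: "\<And>i. i \<in> {1, 2} \<Longrightarrow> depends_on_means (F i) \<and> linear_growth (F i)"
    and G: "\<And>i. i \<in> {1, 2} \<Longrightarrow> depends_on_means (G i)"
    and lam: "lam 1 > 0" "lam 2 > 0"
    and F_mono: "\<And>p1 p2 q1 q2. pdens1 p1 \<Longrightarrow> pdens1 p2 \<Longrightarrow> pdens1 q1 \<Longrightarrow> pdens1 q2 \<Longrightarrow>
           C2fun p1 \<Longrightarrow> C2fun p2 \<Longrightarrow> C2fun q1 \<Longrightarrow> C2fun q2 \<Longrightarrow>
           Mean (dens p1) \<noteq> Mean (dens q1) \<or> Mean (dens p2) \<noteq> Mean (dens q2) \<Longrightarrow>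
           LL_sum lam F (dens p1) (dens p2) (dens q1) (dens q2) > 0"
    and G_mono: "\<And>p1 p2 q1 q2. pdens1 p1 \<Longrightarrow> pdens1 p2 \<Longrightarrow> pdens1 q1 \<Longrightarrow> pdens1 q2 \<Longrightarrow>
           C2fun p1 \<Longrightarrow> C2fun p2 \<Longrightarrow> C2fun q1 \<Longrightarrow> C2fun q2 \<Longrightarrow>
           LL_sum lam G (dens p1) (dens p2) (dens q1) (dens q2) \<ge> 0"
    and sol: "MFG_solution T H \<sigma> F G \<nu> v m"
    and sol': "MFG_solution T H \<sigma> F G \<nu> v' m'"
begin

abbreviation w :: "nat \<Rightarrow> real \<Rightarrow> real \<Rightarrow> real" where
  "w i t x \<equiv> v i t x - v' i t x"

abbreviation wt :: "nat \<Rightarrow> real \<Rightarrow> real \<Rightarrow> real" where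
  "wt i t x \<equiv> dt (v i) t x - dt (v' i) t x"

abbreviation wx :: "nat \<Rightarrow> real \<Rightarrow> real \<Rightarrow> real" where
  "wx i t x \<equiv> dx (v i) t x - dx (v' i) t x"

abbreviation wxx :: "nat \<Rightarrow> real \<Rightarrow> real \<Rightarrow> real" where
  "wxx i t x \<equiv> dxx (v i) t x - dxx (v' i) t x"

definition coupling_diff :: "nat \<Rightarrow> real \<Rightarrow> real \<Rightarrow> real" where
  "coupling_diff i t x = F i x (dens (m 1 t)) (dens (m 2 t)) - F i x (dens (m' 1 t)) (dens (m' 2 t))"

lemma C12s:
  assumes "i \<in> {1, 2}"
  shows "C12 T (v i)" "C12 T (m i)" "C12 T (v' i)" "C12 T (m' i)"
  using sol sol' assms unfolding MFG_solution_def by blast+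

lemma pds:
  assumes "i \<in> {1, 2}" "t \<in> {0..T}"
  shows "pdens1 (m i t)" "pdens1 (m' i t)"
  using sol sol' assms unfolding MFG_solution_def by blast+

lemma terminal:
  assumes "i \<in> {1, 2}"
  shows "v i T x = G i x (dens (m 1 T)) (dens (m 2 T))" "v' i T x = G i x (dens (m' 1 T)) (dens (m' 2 T))"
  using sol sol' assms unfolding MFG_solution_def by blast+

lemma initial: "i \<in> {1, 2} \<Longrightarrow> m i 0 x = m' i 0 x"
  using sol sol' unfolding MFG_solution_def by metis

lemma hjb:
  assumes "i \<in> {1, 2}" "t \<in> {0<..<T}"
  shows "H i differentiable (at (dx (v i) t x))" "H i differentiable (at (dx (v' i) t x))"
    "wt i t x + (\<sigma> i)\<^sup>2 / 2 * wxx i t x = H i (dx (v i) t x) - H i (dx (v' i) t x) - coupling_diff i t x"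
proof -
  have *: "H i differentiable (at (dx (v i) t x)) \<and> - dt (v i) t x + H i (dx (v i) t x)
      = (\<sigma> i)\<^sup>2 / 2 * dxx (v i) t x + F i x (dens (m 1 t)) (dens (m 2 t))"
    "H i differentiable (at (dx (v' i) t x)) \<and> - dt (v' i) t x + H i (dx (v' i) t x)
      = (\<sigma> i)\<^sup>2 / 2 * dxx (v' i) t x + F i x (dens (m' 1 t)) (dens (m' 2 t))"
    using sol sol' assms unfolding MFG_solution_def by blast+
  then show "H i differentiable (at (dx (v i) t x))" "H i differentiable (at (dx (v' i) t x))" by auto
  show "wt i t x + (\<sigma> i)\<^sup>2 / 2 * wxx i t x = H i (dx (v i) t x) - H i (dx (v' i) t x) - coupling_diff i t x"
    using * unfolding coupling_diff_def by (simp add: algebra_simps)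
qed

lemma growth:
  assumes i: "i \<in> {1, 2}"
  shows "\<exists>C. (\<forall>t\<in>{0..T}. \<forall>x. \<bar>w i t x\<bar> \<le> C * (1 + \<bar>x\<bar>)) \<and> (\<forall>t\<in>{0<..<T}. \<forall>x. \<bar>wx i t x\<bar> \<le> C * (1 + \<bar>x\<bar>))"
proof -
  obtain C where C: "\<And>t x. t \<in> {0..T} \<Longrightarrow> \<bar>v i t x\<bar> \<le> C * (1 + \<bar>x\<bar>)"
    "\<And>t x. t \<in> {0<..<T} \<Longrightarrow> \<bar>dx (v i) t x\<bar> \<le> C * (1 + \<bar>x\<bar>)"
    using sol i unfolding MFG_solution_def by meson
  obtain C' where C': "\<And>t x. t \<in> {0..T} \<Longrightarrow> \<bar>v' i t x\<bar> \<le> C' * (1 + \<bar>x\<bar>)"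
    "\<And>t x. t \<in> {0<..<T} \<Longrightarrow> \<bar>dx (v' i) t x\<bar> \<le> C' * (1 + \<bar>x\<bar>)"
    using sol' i unfolding MFG_solution_def by meson
  show ?thesis
  proof (intro exI[of _ "C + C'"] conjI ballI allI)
    show "\<bar>w i t x\<bar> \<le> (C + C') * (1 + \<bar>x\<bar>)" if "t \<in> {0..T}" for t x
      unfolding distrib_right[of C] using C(1)[OF that, of x] C'(1)[OF that, of x] by linarith
    show "\<bar>wx i t x\<bar> \<le> (C + C') * (1 + \<bar>x\<bar>)" if "t \<in> {0<..<T}" for t x
      unfolding distrib_right[of C] using C(2)[OF that, of x] C'(2)[OF that, of x] by linarith
  qed
qed

lemma w_derivs:
  assumes "i \<in> {1, 2}" "t \<in> {0<..<T}"
  shows "((\<lambda>s. w i s x) has_real_derivative wt i t x) (at t)"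
    "((\<lambda>x. w i t x) has_real_derivative wx i t x) (at x)"
    "((\<lambda>x. wx i t x) has_real_derivative wxx i t x) (at x)"
  using C12_derivs[OF C12s(1)[OF assms(1)] assms(2)] C12_derivs[OF C12s(3)[OF assms(1)] assms(2)]
  by (auto intro!: DERIV_diff)

lemma w_cont:
  assumes "i \<in> {1, 2}"
  shows "continuous_on ({0..T} \<times> UNIV) (\<lambda>(t, x). w i t x)"
    "continuous_on ({0<..<T} \<times> UNIV) (\<lambda>(t, x). wt i t x)"
    "continuous_on ({0<..<T} \<times> UNIV) (\<lambda>(t, x). dx (v i) t x)"
    "continuous_on ({0<..<T} \<times> UNIV) (\<lambda>(t, x). dx (v' i) t x)"
    "continuous_on ({0<..<T} \<times> UNIV) (\<lambda>(t, x). wxx i t x)"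
  using C12s(1,3)[OF assms] unfolding C12_def split_def by (auto intro!: continuous_intros)

lemma coupling_diff_cont:
  assumes i: "i \<in> {1, 2}"
  shows "continuous_on ({0<..<T} \<times> UNIV) (\<lambda>(t, x). coupling_diff i t x)"
proof -
  obtain L where "L-lipschitz_on UNIV (H i)" using H[OF i] by blast
  then have Hc: "continuous_on UNIV (H i)" by (rule lipschitz_on_continuous_on)
  note c = w_cont(2-5)[OF i, unfolded split_def]
  have "continuous_on ({0<..<T} \<times> UNIV) (\<lambda>z. H i (dx (v i) (fst z) (snd z)) - H i (dx (v' i) (fst z) (snd z))
      - (wt i (fst z) (snd z) + (\<sigma> i)\<^sup>2 / 2 * wxx i (fst z) (snd z)))"
    by (rule continuous_on_diff[OF continuous_on_diff[OF continuous_on_compose2[OF Hc c(2) subset_UNIV]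
            continuous_on_compose2[OF Hc c(3) subset_UNIV]]
          continuous_on_add[OF c(1) continuous_on_mult[OF continuous_on_const c(4)]]])
  moreover have "coupling_diff i (fst z) (snd z) = H i (dx (v i) (fst z) (snd z)) - H i (dx (v' i) (fst z) (snd z))
      - (wt i (fst z) (snd z) + (\<sigma> i)\<^sup>2 / 2 * wxx i (fst z) (snd z))" if "z \<in> {0<..<T} \<times> UNIV" for z
    using hjb(3)[OF i, of "fst z" "snd z"] that by auto
  ultimately show ?thesis unfolding split_def by (simp cong: continuous_on_cong)
qed

lemma fp:
  assumes "i \<in> {1, 2}" "L-lipschitz_on UNIV (H i)"
  shows "fokker_planck T ((\<sigma> i)\<^sup>2 / 2) L (m i) (dt (m i)) (dx (m i)) (dxx (m i))
      (\<lambda>t x. deriv (H i) (dx (v i) t x) * m i t x)"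
    "fokker_planck T ((\<sigma> i)\<^sup>2 / 2) L (m' i) (dt (m' i)) (dx (m' i)) (dxx (m' i))
      (\<lambda>t x. deriv (H i) (dx (v' i) t x) * m' i t x)"
  using MFG_solution_fokker_planck[OF sol assms(1) T assms(2)]
    MFG_solution_fokker_planck[OF sol' assms(1) T assms(2)] by auto

lemma abs_moment_bounded:
  assumes i: "i \<in> {1, 2}"
  shows "\<exists>M. \<forall>t\<in>{0..T}. (\<integral>x. \<bar>x\<bar> \<partial>dens (m i t)) \<le> M \<and> (\<integral>x. \<bar>x\<bar> \<partial>dens (m' i t)) \<le> M"
proof -
  obtain L where lip: "L-lipschitz_on UNIV (H i)" using H[OF i] by blast
  interpret A: fokker_planck T "(\<sigma> i)\<^sup>2 / 2" L "m i" "dt (m i)" "dx (m i)" "dxx (m i)"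
    "\<lambda>t x. deriv (H i) (dx (v i) t x) * m i t x" by (rule fp(1)[OF i lip])
  interpret B: fokker_planck T "(\<sigma> i)\<^sup>2 / 2" L "m' i" "dt (m' i)" "dx (m' i)" "dxx (m' i)"
    "\<lambda>t x. deriv (H i) (dx (v' i) t x) * m' i t x" by (rule fp(2)[OF i lip])
  obtain M where M: "\<And>t. t \<in> {0..T} \<Longrightarrow> (LINT x|lborel. (1 + \<bar>x\<bar>) * m i t x) \<le> M" using A.moment_bounded by blast
  obtain M' where M': "\<And>t. t \<in> {0..T} \<Longrightarrow> (LINT x|lborel. (1 + \<bar>x\<bar>) * m' i t x) \<le> M'" using B.moment_bounded by blast
  have le: "(\<integral>x. \<bar>x\<bar> \<partial>dens p) \<le> (LINT x|lborel. (1 + \<bar>x\<bar>) * p x)" if "pdens1 p" for p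
  proof -
    have "(\<integral>x. \<bar>x\<bar> \<partial>dens p) = (LINT x|lborel. \<bar>x\<bar> * p x)" by (rule integral_dens[OF that]) measurable
    also have "\<dots> \<le> \<bar>LINT x|lborel. \<bar>x\<bar> * p x\<bar>" by simp
    also have "\<dots> \<le> (LINT x|lborel. (1 + \<bar>x\<bar>) * p x)"
      by (rule pdens1_integral_bound[OF that, where C=1]) auto
    finally show ?thesis .
  qed
  show ?thesis
    using order_trans[OF le[OF pds(1)[OF i]] M] order_trans[OF le[OF pds(2)[OF i]] M']
    by (intro exI[of _ "max M M'"]) (auto simp: le_max_iff_disj)
qed

lemma coupling_diff_growth:
  assumes i: "i \<in> {1, 2}"
  shows "\<exists>C. \<forall>t\<in>{0..T}. \<forall>x. \<bar>coupling_diff i t x\<bar> \<le> C * (1 + \<bar>x\<bar>)"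
proof -
  obtain M1 where M1: "\<And>t. t \<in> {0..T} \<Longrightarrow> (\<integral>x. \<bar>x\<bar> \<partial>dens (m 1 t)) \<le> M1 \<and> (\<integral>x. \<bar>x\<bar> \<partial>dens (m' 1 t)) \<le> M1"
    using abs_moment_bounded[of 1] by blast
  obtain M2 where M2: "\<And>t. t \<in> {0..T} \<Longrightarrow> (\<integral>x. \<bar>x\<bar> \<partial>dens (m 2 t)) \<le> M2 \<and> (\<integral>x. \<bar>x\<bar> \<partial>dens (m' 2 t)) \<le> M2"
    using abs_moment_bounded[of 2] by blast
  have "linear_growth (F i)" using F[OF i] by blast
  then obtain C where C: "\<And>\<mu>1 \<mu>2 x. \<mu>1 \<in> P1 \<Longrightarrow> \<mu>2 \<in> P1 \<Longrightarrow> (\<integral>x. \<bar>x\<bar> \<partial>\<mu>1) \<le> max M1 M2 \<Longrightarrow> (\<integral>x. \<bar>x\<bar> \<partial>\<mu>2) \<le> max M1 M2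
      \<Longrightarrow> \<bar>F i x \<mu>1 \<mu>2\<bar> \<le> C * (1 + \<bar>x\<bar>)"
    unfolding linear_growth_def by meson
  have "\<bar>coupling_diff i t x\<bar> \<le> (C + C) * (1 + \<bar>x\<bar>)" if t: "t \<in> {0..T}" for t x
  proof -
    have "\<bar>F i x (dens (m 1 t)) (dens (m 2 t))\<bar> \<le> C * (1 + \<bar>x\<bar>)"
      "\<bar>F i x (dens (m' 1 t)) (dens (m' 2 t))\<bar> \<le> C * (1 + \<bar>x\<bar>)"
      using M1[OF t] M2[OF t] pds[of 1, OF _ t] pds[of 2, OF _ t]
      by (auto intro!: C dens_in_P1 simp: le_max_iff_disj)
    then show ?thesis unfolding coupling_diff_def distrib_right[of C] by linarith
  qed
  then show ?thesis by blast
qed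

lemma pairing_derivative:
  assumes i: "i \<in> {1, 2}"
  shows "\<exists>\<kappa>. \<kappa> \<longlonglongrightarrow> 0 \<and> (\<forall>n\<ge>1. \<forall>t\<in>{0<..<T}. \<exists>D.
    ((\<lambda>t. integral {- real n..real n} (\<lambda>x. cutoff (real n) x * w i t x * m i t x)
        + integral {- real n..real n} (\<lambda>x. cutoff (real n) x * - w i t x * m' i t x)) has_real_derivative D) (at t) \<and>
    D \<le> - ((LINT x|lborel. coupling_diff i t x * m i t x) - (LINT x|lborel. coupling_diff i t x * m' i t x)) + \<kappa> n)"
proof -
  obtain L where lip: "L-lipschitz_on UNIV (H i)" using H[OF i] by blast
  interpret A: fokker_planck T "(\<sigma> i)\<^sup>2 / 2" L "m i" "dt (m i)" "dx (m i)" "dxx (m i)"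
    "\<lambda>t x. deriv (H i) (dx (v i) t x) * m i t x" by (rule fp(1)[OF i lip])
  interpret B: fokker_planck T "(\<sigma> i)\<^sup>2 / 2" L "m' i" "dt (m' i)" "dx (m' i)" "dxx (m' i)"
    "\<lambda>t x. deriv (H i) (dx (v' i) t x) * m' i t x" by (rule fp(2)[OF i lip])
  have tangent: "deriv (H i) p * (q - p) \<le> H i q - H i p" if "H i differentiable (at p)" for p q
    using that H[OF i]
    by (intro convex_on_imp_above_tangent[where A=UNIV]) (auto simp: DERIV_deriv_iff_real_differentiable)
  obtain C1 where C1: "\<And>t x. t \<in> {0..T} \<Longrightarrow> \<bar>w i t x\<bar> \<le> C1 * (1 + \<bar>x\<bar>)" "\<And>t x. t \<in> {0<..<T} \<Longrightarrow> \<bar>wx i t x\<bar> \<le> C1 * (1 + \<bar>x\<bar>)"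
    using growth[OF i] by blast
  obtain C2 where C2: "\<And>t x. t \<in> {0..T} \<Longrightarrow> \<bar>coupling_diff i t x\<bar> \<le> C2 * (1 + \<bar>x\<bar>)"
    using coupling_diff_growth[OF i] by blast
  define C where "C = max C1 C2"
  have C: "\<bar>w i t x\<bar> \<le> C * (1 + \<bar>x\<bar>)" "\<bar>wx i t x\<bar> \<le> C * (1 + \<bar>x\<bar>)" "\<bar>coupling_diff i t x\<bar> \<le> C * (1 + \<bar>x\<bar>)"
    if "t \<in> {0<..<T}" for t x
  proof -
    have "C1 * (1 + \<bar>x\<bar>) \<le> C * (1 + \<bar>x\<bar>)" "C2 * (1 + \<bar>x\<bar>) \<le> C * (1 + \<bar>x\<bar>)"
      unfolding C_def by (intro mult_right_mono; simp)+
    then show "\<bar>w i t x\<bar> \<le> C * (1 + \<bar>x\<bar>)" "\<bar>wx i t x\<bar> \<le> C * (1 + \<bar>x\<bar>)" "\<bar>coupling_diff i t x\<bar> \<le> C * (1 + \<bar>x\<bar>)"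
      using C1(1)[of t x] C1(2)[OF that, of x] C2[of t x] that by auto
  qed
  have cw: "continuous_on ({0<..<T} \<times> UNIV) (\<lambda>(t, x). w i t x)"
    by (rule continuous_on_subset[OF w_cont(1)[OF i]]) auto
  note cf = continuous_on_slice[OF coupling_diff_cont[OF i]]
  have "\<exists>\<kappa>. \<kappa> \<longlonglongrightarrow> 0 \<and> (\<forall>n\<ge>1. \<forall>t\<in>{0<..<T}. \<exists>D.
    ((\<lambda>t. integral {- real n..real n} (\<lambda>x. cutoff (real n) x * w i t x * m i t x)) has_real_derivative D) (at t) \<and>
    D \<le> - (LINT x|lborel. coupling_diff i t x * m i t x) + \<kappa> n)"
  proof (rule A.weak_inequality[OF cw w_derivs(1)[OF i] w_cont(2)[OF i] w_derivs(2)[OF i] w_derivs(3)[OF i] w_cont(5)[OF i]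
        C(1) C(2) cf C(3)])
    fix t x assume t: "t \<in> {0<..<T}"
    have "(H i (dx (v i) t x) - H i (dx (v' i) t x) - deriv (H i) (dx (v i) t x) * wx i t x) * m i t x \<le> 0 * m i t x"
      using tangent[OF hjb(1)[OF i t], of x "dx (v' i) t x"] A.nonneg[of t x] t
      by (intro mult_right_mono) (auto simp: algebra_simps)
    then show "(wt i t x + (\<sigma> i)\<^sup>2 / 2 * wxx i t x) * m i t x - deriv (H i) (dx (v i) t x) * m i t x * wx i t x
        \<le> - coupling_diff i t x * m i t x"
      unfolding hjb(3)[OF i t] by (simp add: algebra_simps)
  qed
  then obtain \<kappa>1 where \<kappa>1: "\<kappa>1 \<longlonglongrightarrow> 0" "\<And>n t. n \<ge> 1 \<Longrightarrow> t \<in> {0<..<T} \<Longrightarrow> \<exists>D.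
    ((\<lambda>t. integral {- real n..real n} (\<lambda>x. cutoff (real n) x * w i t x * m i t x)) has_real_derivative D) (at t) \<and>
    D \<le> - (LINT x|lborel. coupling_diff i t x * m i t x) + \<kappa>1 n"
    by blast
  have "\<exists>\<kappa>. \<kappa> \<longlonglongrightarrow> 0 \<and> (\<forall>n\<ge>1. \<forall>t\<in>{0<..<T}. \<exists>D.
    ((\<lambda>t. integral {- real n..real n} (\<lambda>x. cutoff (real n) x * - w i t x * m' i t x)) has_real_derivative D) (at t) \<and>
    D \<le> - (LINT x|lborel. - coupling_diff i t x * m' i t x) + \<kappa> n)"
  proof (rule B.weak_inequality[where ut="\<lambda>t x. - wt i t x" and ux="\<lambda>t x. - wx i t x" and uxx="\<lambda>t x. - wxx i t x" and C=C])
    show "continuous_on ({0<..<T} \<times> UNIV) (\<lambda>(t, x). - w i t x)" "continuous_on ({0<..<T} \<times> UNIV) (\<lambda>(t, x). - wt i t x)"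
      "continuous_on ({0<..<T} \<times> UNIV) (\<lambda>(t, x). - wxx i t x)"
      using continuous_on_minus[OF cw] continuous_on_minus[OF w_cont(2)[OF i]] continuous_on_minus[OF w_cont(5)[OF i]]
      by (simp_all only: split_def)
    fix t assume t: "t \<in> {0<..<T}"
    show "continuous_on UNIV (\<lambda>x. - coupling_diff i t x)" by (rule continuous_on_minus[OF cf[OF t]])
    fix x
    show "((\<lambda>s. - w i s x) has_real_derivative - wt i t x) (at t)"
      "((\<lambda>x. - w i t x) has_real_derivative - wx i t x) (at x)"
      "((\<lambda>x. - wx i t x) has_real_derivative - wxx i t x) (at x)"
      by (rule DERIV_minus w_derivs[OF i t])+
    show "\<bar>- w i t x\<bar> \<le> C * (1 + \<bar>x\<bar>)" "\<bar>- wx i t x\<bar> \<le> C * (1 + \<bar>x\<bar>)" "\<bar>- coupling_diff i t x\<bar> \<le> C * (1 + \<bar>x\<bar>)"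
      using C[OF t, of x] by (simp_all only: abs_minus_cancel)
    have "(H i (dx (v' i) t x) - H i (dx (v i) t x) + deriv (H i) (dx (v' i) t x) * wx i t x) * m' i t x \<le> 0 * m' i t x"
      using tangent[OF hjb(2)[OF i t], of x "dx (v i) t x"] B.nonneg[of t x] t
      by (intro mult_right_mono) (auto simp: algebra_simps)
    moreover have "- wt i t x + (\<sigma> i)\<^sup>2 / 2 * - wxx i t x = H i (dx (v' i) t x) - H i (dx (v i) t x) + coupling_diff i t x"
      using hjb(3)[OF i t, of x] by (simp only: mult_minus_right)
    ultimately show "(- wt i t x + (\<sigma> i)\<^sup>2 / 2 * - wxx i t x) * m' i t x - deriv (H i) (dx (v' i) t x) * m' i t x * - wx i t x
        \<le> - (- coupling_diff i t x) * m' i t x"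
      by (simp only:) (simp add: algebra_simps)
  qed
  then obtain \<kappa>2 where \<kappa>2: "\<kappa>2 \<longlonglongrightarrow> 0" "\<And>n t. n \<ge> 1 \<Longrightarrow> t \<in> {0<..<T} \<Longrightarrow> \<exists>D.
    ((\<lambda>t. integral {- real n..real n} (\<lambda>x. cutoff (real n) x * - w i t x * m' i t x)) has_real_derivative D) (at t) \<and>
    D \<le> - (LINT x|lborel. - coupling_diff i t x * m' i t x) + \<kappa>2 n"
    by blast
  show ?thesis
  proof (intro exI[of _ "\<lambda>n. \<kappa>1 n + \<kappa>2 n"] conjI allI impI ballI)
    show "(\<lambda>n. \<kappa>1 n + \<kappa>2 n) \<longlonglongrightarrow> 0" using tendsto_add[OF \<kappa>1(1) \<kappa>2(1)] by simp
    fix n :: nat and t assume n: "1 \<le> n" and t: "t \<in> {0<..<T}"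
    obtain D1 D2 where D: "((\<lambda>t. integral {- real n..real n} (\<lambda>x. cutoff (real n) x * w i t x * m i t x)) has_real_derivative D1) (at t)"
      "D1 \<le> - (LINT x|lborel. coupling_diff i t x * m i t x) + \<kappa>1 n"
      "((\<lambda>t. integral {- real n..real n} (\<lambda>x. cutoff (real n) x * - w i t x * m' i t x)) has_real_derivative D2) (at t)"
      "D2 \<le> - (LINT x|lborel. - coupling_diff i t x * m' i t x) + \<kappa>2 n"
      using \<kappa>1(2)[OF n t] \<kappa>2(2)[OF n t] by blast
    have "(LINT x|lborel. - coupling_diff i t x * m' i t x) = - (LINT x|lborel. coupling_diff i t x * m' i t x)"
      by simp
    then show "\<exists>D. ((\<lambda>t. integral {- real n..real n} (\<lambda>x. cutoff (real n) x * w i t x * m i t x)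
        + integral {- real n..real n} (\<lambda>x. cutoff (real n) x * - w i t x * m' i t x)) has_real_derivative D) (at t) \<and>
      D \<le> - ((LINT x|lborel. coupling_diff i t x * m i t x) - (LINT x|lborel. coupling_diff i t x * m' i t x)) + (\<kappa>1 n + \<kappa>2 n)"
      using DERIV_add[OF D(1,3)] D(2,4) by (intro exI[of _ "D1 + D2"]) auto
  qed
qed

lemma expectation_continuous:
  assumes i: "i \<in> {1, 2}" and k: "continuous_on (S \<times> UNIV) (\<lambda>(t, x). k t x)" and S: "S \<subseteq> {0..T}"
    and growth: "\<And>t x. t \<in> S \<Longrightarrow> \<bar>k t x\<bar> \<le> C * (1 + \<bar>x\<bar>)"
  shows "continuous_on S (\<lambda>t. LINT x|lborel. k t x * m i t x)"
    "continuous_on S (\<lambda>t. LINT x|lborel. k t x * m' i t x)"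
proof -
  obtain L where lip: "L-lipschitz_on UNIV (H i)" using H[OF i] by blast
  show "continuous_on S (\<lambda>t. LINT x|lborel. k t x * m i t x)"
    by (rule fokker_planck.continuous_on_expectation[OF fp(1)[OF i lip] k S growth])
  show "continuous_on S (\<lambda>t. LINT x|lborel. k t x * m' i t x)"
    by (rule fokker_planck.continuous_on_expectation[OF fp(2)[OF i lip] k S growth])
qed

lemma mean_continuous:
  assumes i: "i \<in> {1, 2}"
  shows "continuous_on {0..T} (\<lambda>t. Mean (dens (m i t)))" "continuous_on {0..T} (\<lambda>t. Mean (dens (m' i t)))"
proof -
  have "continuous_on ({0..T} \<times> UNIV) (\<lambda>(t, x). x)" unfolding split_def by (intro continuous_intros)
  note c = expectation_continuous[OF i this order_refl, of 1]
  have c': "continuous_on {0..T} (\<lambda>t. LINT x|lborel. x * m i t x)"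
    "continuous_on {0..T} (\<lambda>t. LINT x|lborel. x * m' i t x)"
    using c by auto
  show "continuous_on {0..T} (\<lambda>t. Mean (dens (m i t)))" "continuous_on {0..T} (\<lambda>t. Mean (dens (m' i t)))"
    by (rule continuous_on_eq[OF c'(1)] continuous_on_eq[OF c'(2)]; simp add: Mean_dens pds[OF i])+
qed

text \<open>The densities at the terminal time need not be \<open>C\<^sup>2\<close>. Since the terminal cost sees only the means, the
  monotonicity of \<open>G\<close> is applied to the densities at earlier times, translated to have the terminal means.\<close>

lemma terminal_monotone:
  "0 \<le> lam 1 * ((LINT x|lborel. w 1 T x * m 1 T x) - (LINT x|lborel. w 1 T x * m' 1 T x)) +
       lam 2 * ((LINT x|lborel. w 2 T x * m 2 T x) - (LINT x|lborel. w 2 T x * m' 2 T x))"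
proof -
  define d where "d i t = Mean (dens (m i T)) - Mean (dens (m i t))" for i t
  define d' where "d' i t = Mean (dens (m' i T)) - Mean (dens (m' i t))" for i t
  define \<Phi> where "\<Phi> i t = (LINT x|lborel. w i T (x + d i t) * m i t x) - (LINT x|lborel. w i T (x + d' i t) * m' i t x)" for i t
  have TT: "T \<in> {0..T}" using T by simp
  have wT: "continuous_on UNIV (\<lambda>x. w i T x)" if "i \<in> {1, 2}" for i
    by (rule continuous_on_slice[OF w_cont(1)[OF that] TT])
  have shifted_cont: "continuous_on {0..T} (\<lambda>t. LINT x|lborel. w i T (x + e t) * m i t x)"
    "continuous_on {0..T} (\<lambda>t. LINT x|lborel. w i T (x + e t) * m' i t x)"
    if i: "i \<in> {1, 2}" and e: "continuous_on {0..T} e" for i e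
  proof -
    obtain C where C: "\<And>x. \<bar>w i T x\<bar> \<le> C * (1 + \<bar>x\<bar>)" using growth[OF i] TT by blast
    have C0: "C \<ge> 0" using C[of 0] by simp
    have "bounded (e ` {0..T})" using e by (intro compact_imp_bounded compact_continuous_image) auto
    then have "\<exists>B. \<forall>t\<in>{0..T}. \<bar>e t\<bar> \<le> B" by (auto simp: bounded_iff)
    then obtain B where B: "\<And>t. t \<in> {0..T} \<Longrightarrow> \<bar>e t\<bar> \<le> B" by blast
    then have B0: "0 \<le> B" using TT by (meson abs_ge_zero order_trans)
    have "continuous_on ({0..T} \<times> UNIV) (\<lambda>z. w i T (snd z + e (fst z)))"
      by (rule continuous_on_compose2[OF wT[OF i]])
        (auto intro!: continuous_intros continuous_on_compose2[OF e])
    then have k: "continuous_on ({0..T} \<times> UNIV) (\<lambda>(t, x). w i T (x + e t))" by (simp add: split_def)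
    have g: "\<bar>w i T (x + e t)\<bar> \<le> (C * (1 + B)) * (1 + \<bar>x\<bar>)" if t: "t \<in> {0..T}" for t x
    proof -
      have "\<bar>w i T (x + e t)\<bar> \<le> C * (1 + \<bar>x + e t\<bar>)" by (rule C)
      also have "\<dots> \<le> C * ((1 + B) * (1 + \<bar>x\<bar>))"
      proof (rule mult_left_mono[OF _ C0])
        have "0 \<le> B * \<bar>x\<bar>" using B0 by simp
        moreover have "(1 + B) * (1 + \<bar>x\<bar>) = 1 + B + \<bar>x\<bar> + B * \<bar>x\<bar>" by (simp add: algebra_simps)
        ultimately show "1 + \<bar>x + e t\<bar> \<le> (1 + B) * (1 + \<bar>x\<bar>)" using B[OF t] by linarith
      qed
      finally show ?thesis by (simp add: mult.assoc)
    qed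
    show "continuous_on {0..T} (\<lambda>t. LINT x|lborel. w i T (x + e t) * m i t x)"
      "continuous_on {0..T} (\<lambda>t. LINT x|lborel. w i T (x + e t) * m' i t x)"
      using expectation_continuous[OF i k order_refl g] by blast+
  qed
  have \<Phi>_cont: "continuous_on {0..T} (\<Phi> i)" if i: "i \<in> {1, 2}" for i
    unfolding \<Phi>_def d_def d'_def
    by (intro continuous_on_diff shifted_cont[OF i] continuous_on_const mean_continuous[OF i])
  have nonneg: "0 \<le> lam 1 * \<Phi> 1 t + lam 2 * \<Phi> 2 t" if t: "t \<in> {0<..<T}" for t
  proof -
    have t0: "t \<in> {0..T}" using t by auto
    define p where "p i x = m i t (x - d i t)" for i x
    define q where "q i x = m' i t (x - d' i t)" for i x
    have pq: "pdens1 (p i)" "pdens1 (q i)" "C2fun (p i)" "C2fun (q i)"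
      "Mean (dens (p i)) = Mean (dens (m i T))" "Mean (dens (q i)) = Mean (dens (m' i T))" if i: "i \<in> {1, 2}" for i
      unfolding p_def q_def
      using C12_shift_C2fun[OF C12s(2)[OF i] t] C12_shift_C2fun[OF C12s(4)[OF i] t]
      by (auto simp: pdens1_shift pds[OF i t0] Mean_dens_shift d_def d'_def)
    have G_eq: "G i x (dens (p 1)) (dens (p 2)) - G i x (dens (q 1)) (dens (q 2)) = w i T x" if i: "i \<in> {1, 2}" for i x
    proof -
      have "G i x (dens (p 1)) (dens (p 2)) = G i x (dens (m 1 T)) (dens (m 2 T))"
        by (rule depends_on_means_dens[OF G[OF i]]) (auto simp: pq pds less_imp_le[OF T])
      moreover have "G i x (dens (q 1)) (dens (q 2)) = G i x (dens (m' 1 T)) (dens (m' 2 T))"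
        by (rule depends_on_means_dens[OF G[OF i]]) (auto simp: pq pds less_imp_le[OF T])
      ultimately show ?thesis by (simp add: terminal[OF i])
    qed
    have wm: "(\<lambda>x. w i T x) \<in> borel_measurable borel" if "i \<in> {1, 2}" for i
      by (rule borel_measurable_continuous_onI[OF wT[OF that]])
    have "0 \<le> LL_sum lam G (dens (p 1)) (dens (p 2)) (dens (q 1)) (dens (q 2))"
      by (rule G_mono) (auto simp: pq)
    also have "\<dots> = lam 1 * ((LINT x|lborel. w 1 T x * p 1 x) - (LINT x|lborel. w 1 T x * q 1 x)) +
        lam 2 * ((LINT x|lborel. w 2 T x * p 2 x) - (LINT x|lborel. w 2 T x * q 2 x))"
    proof (rule LL_sum_dens[where f="\<lambda>i x. w i T x"])
      show "G 1 x (dens (p 1)) (dens (p 2)) - G 1 x (dens (q 1)) (dens (q 2)) = w 1 T x"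
        "G 2 x (dens (p 1)) (dens (p 2)) - G 2 x (dens (q 1)) (dens (q 2)) = w 2 T x" for x
        by (rule G_eq; simp)+
    qed (auto simp: pq intro!: wm)
    also have "\<dots> = lam 1 * \<Phi> 1 t + lam 2 * \<Phi> 2 t"
      unfolding p_def q_def \<Phi>_def lborel_integral_shift[of "\<lambda>x. w _ T x"] ..
    finally show ?thesis .
  qed
  have "0 \<le> lam 1 * \<Phi> 1 T + lam 2 * \<Phi> 2 T"
  proof (rule continuous_ge_on_closure[where S="{0<..<T}" and f="\<lambda>t. lam 1 * \<Phi> 1 t + lam 2 * \<Phi> 2 t"])
    show "continuous_on (closure {0<..<T}) (\<lambda>t. lam 1 * \<Phi> 1 t + lam 2 * \<Phi> 2 t)"
      using T \<Phi>_cont by (auto intro!: continuous_intros)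
  qed (use T nonneg in auto)
  then show ?thesis by (simp add: \<Phi>_def d_def d'_def)
qed

lemma means_equal_interior:
  assumes t: "t \<in> {0<..<T}"
  shows "Mean (dens (m 1 t)) = Mean (dens (m' 1 t)) \<and> Mean (dens (m 2 t)) = Mean (dens (m' 2 t))"
proof (rule ccontr)
  assume contra: "\<not> ?thesis"
  have one_two: "(1::nat) \<in> {1, 2}" "(2::nat) \<in> {1, 2}" by auto
  define E where "E i n t = integral {- real n..real n} (\<lambda>x. cutoff (real n) x * w i t x * m i t x)
        + integral {- real n..real n} (\<lambda>x. cutoff (real n) x * - w i t x * m' i t x)" for i n t
  define l where "l i t = (LINT x|lborel. coupling_diff i t x * m i t x) - (LINT x|lborel. coupling_diff i t x * m' i t x)" for i t
  define \<Lambda> where "\<Lambda> t = lam 1 * l 1 t + lam 2 * l 2 t" for t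
  have \<Lambda>_LL: "\<Lambda> t = LL_sum lam F (dens (m 1 t)) (dens (m 2 t)) (dens (m' 1 t)) (dens (m' 2 t))" if t: "t \<in> {0<..<T}" for t
    unfolding \<Lambda>_def l_def
  proof (rule LL_sum_dens[where f="\<lambda>i x. coupling_diff i t x", symmetric])
    show "F 1 x (dens (m 1 t)) (dens (m 2 t)) - F 1 x (dens (m' 1 t)) (dens (m' 2 t)) = coupling_diff 1 t x"
      "F 2 x (dens (m 1 t)) (dens (m 2 t)) - F 2 x (dens (m' 1 t)) (dens (m' 2 t)) = coupling_diff 2 t x" for x
      by (rule coupling_diff_def[symmetric])+
  qed (use t in \<open>auto simp: pds
         intro!: borel_measurable_continuous_onI continuous_on_slice[OF coupling_diff_cont]\<close>)
  have \<Lambda>_pos: "0 < \<Lambda> t"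
    if t: "t \<in> {0<..<T}" and "Mean (dens (m 1 t)) \<noteq> Mean (dens (m' 1 t)) \<or> Mean (dens (m 2 t)) \<noteq> Mean (dens (m' 2 t))" for t
    unfolding \<Lambda>_LL[OF t]
    by (rule F_mono) (use that C12_shift_C2fun[OF C12s(2) t, where d=0] C12_shift_C2fun[OF C12s(4) t, where d=0] pds in auto)
  have \<Lambda>_nonneg: "0 \<le> \<Lambda> t" if t: "t \<in> {0<..<T}" for t
  proof (cases "Mean (dens (m 1 t)) = Mean (dens (m' 1 t)) \<and> Mean (dens (m 2 t)) = Mean (dens (m' 2 t))")
    case True
    have "coupling_diff i t x = 0" if i: "i \<in> {1, 2}" for i x
      using depends_on_means_dens[of "F i" "m 1 t" "m 2 t" "m' 1 t" "m' 2 t" x] F[OF i] True t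
      by (simp add: coupling_diff_def pds)
    then show ?thesis by (simp add: \<Lambda>_def l_def)
  next
    case False
    then show ?thesis using \<Lambda>_pos[OF t] by auto
  qed
  have l_cont: "continuous_on {0<..<T} (l i)" if i: "i \<in> {1, 2}" for i
  proof -
    obtain C where C: "\<And>t x. t \<in> {0..T} \<Longrightarrow> \<bar>coupling_diff i t x\<bar> \<le> C * (1 + \<bar>x\<bar>)"
      using coupling_diff_growth[OF i] by blast
    have "{0<..<T} \<subseteq> {0..T}" by auto
    note c = expectation_continuous[OF i coupling_diff_cont[OF i] this, of C]
    show ?thesis unfolding l_def by (intro continuous_on_diff c C) auto
  qed
  obtain \<kappa>1 where \<kappa>1: "\<kappa>1 \<longlonglongrightarrow> 0" "\<And>n t. n \<ge> 1 \<Longrightarrow> t \<in> {0<..<T} \<Longrightarrow>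
      \<exists>D. (E 1 n has_real_derivative D) (at t) \<and> D \<le> - l 1 t + \<kappa>1 n"
    using pairing_derivative[OF one_two(1)] unfolding E_def[abs_def] l_def by blast
  obtain \<kappa>2 where \<kappa>2: "\<kappa>2 \<longlonglongrightarrow> 0" "\<And>n t. n \<ge> 1 \<Longrightarrow> t \<in> {0<..<T} \<Longrightarrow>
      \<exists>D. (E 2 n has_real_derivative D) (at t) \<and> D \<le> - l 2 t + \<kappa>2 n"
    using pairing_derivative[OF one_two(2)] unfolding E_def[abs_def] l_def by blast
  have E_cont: "continuous_on {0..T} (E i n)" if i: "i \<in> {1, 2}" and n: "n \<ge> 1" for i n
  proof -
    obtain L where lip: "L-lipschitz_on UNIV (H i)" using H[OF i] by blast
    have "continuous_on ({0..T} \<times> UNIV) (\<lambda>(t, x). - w i t x)"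
      using continuous_on_minus[OF w_cont(1)[OF i]] by (simp only: split_def)
    then show ?thesis unfolding E_def using n w_cont(1)[OF i]
      by (intro continuous_on_add fokker_planck.continuous_on_cutoff_integral[OF fp(1)[OF i lip]]
          fokker_planck.continuous_on_cutoff_integral[OF fp(2)[OF i lip]]) auto
  qed
  have E_T: "(\<lambda>n. E i n T) \<longlonglongrightarrow> (LINT x|lborel. w i T x * m i T x) - (LINT x|lborel. w i T x * m' i T x)"
    if i: "i \<in> {1, 2}" for i
  proof -
    have TT: "T \<in> {0..T}" using T by simp
    obtain C where C: "\<And>x. \<bar>w i T x\<bar> \<le> C * (1 + \<bar>x\<bar>)" using growth[OF i] TT by blast
    have wm: "(\<lambda>x. w i T x) \<in> borel_measurable borel"
      by (rule borel_measurable_continuous_onI[OF continuous_on_slice[OF w_cont(1)[OF i] TT]])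
    have I: "integrable lborel (\<lambda>x. w i T x * m i T x)" "integrable lborel (\<lambda>x. - w i T x * m' i T x)"
      by (rule pdens1_integrable_growth[OF pds(1)[OF i TT] wm C],
          rule pdens1_integrable_growth[OF pds(2)[OF i TT] borel_measurable_uminus[OF wm]])
        (use C in \<open>simp only: abs_minus_cancel\<close>)
    have "(\<lambda>n. E i n T) \<longlonglongrightarrow> (LINT x|lborel. w i T x * m i T x) + (LINT x|lborel. - w i T x * m' i T x)"
      unfolding E_def using tendsto_add[OF cutoff_integral_tendsto[OF I(1)] cutoff_integral_tendsto[OF I(2)]]
      by (simp only: mult.assoc)
    moreover have "(LINT x|lborel. - w i T x * m' i T x) = - (LINT x|lborel. w i T x * m' i T x)"
      unfolding mult_minus_left by (rule Bochner_Integration.integral_minus)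
    ultimately show ?thesis by simp
  qed
  have E_0: "E i n 0 = 0" if i: "i \<in> {1, 2}" for i n
    unfolding E_def initial[OF i] by (simp only: mult_minus_left mult_minus_right integral_neg add.right_inverse)
  have "\<Lambda> t = 0"
  proof (rule vanishing_dissipation[where A="\<lambda>n t. lam 1 * E 1 n t + lam 2 * E 2 n t"
        and \<kappa>="\<lambda>n. lam 1 * \<kappa>1 n + lam 2 * \<kappa>2 n", OF _ _ _ \<Lambda>_nonneg _ _ _ terminal_monotone t])
    show "continuous_on {0..T} (\<lambda>t. lam 1 * E 1 n t + lam 2 * E 2 n t)" if "n \<ge> 1" for n
      using that by (intro continuous_intros E_cont) auto
    show "continuous_on {0<..<T} \<Lambda>" unfolding \<Lambda>_def by (intro continuous_intros l_cont) auto
    show "lam 1 * E 1 n 0 + lam 2 * E 2 n 0 = 0" for n by (simp add: E_0)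
    show "(\<lambda>n. lam 1 * E 1 n T + lam 2 * E 2 n T) \<longlonglongrightarrow>
      lam 1 * ((LINT x|lborel. w 1 T x * m 1 T x) - (LINT x|lborel. w 1 T x * m' 1 T x)) +
      lam 2 * ((LINT x|lborel. w 2 T x * m 2 T x) - (LINT x|lborel. w 2 T x * m' 2 T x))"
      by (intro tendsto_intros E_T one_two)
    have "(\<lambda>n. lam 1 * \<kappa>1 n + lam 2 * \<kappa>2 n) \<longlonglongrightarrow> lam 1 * 0 + lam 2 * 0" by (intro tendsto_intros \<kappa>1 \<kappa>2)
    then show "(\<lambda>n. lam 1 * \<kappa>1 n + lam 2 * \<kappa>2 n) \<longlonglongrightarrow> 0" by simp
    fix n :: nat and s assume n: "n \<ge> 1" and s: "s \<in> {0<..<T}"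
    obtain D1 D2 where D: "(E 1 n has_real_derivative D1) (at s)" "D1 \<le> - l 1 s + \<kappa>1 n"
      "(E 2 n has_real_derivative D2) (at s)" "D2 \<le> - l 2 s + \<kappa>2 n"
      using \<kappa>1(2)[OF n s] \<kappa>2(2)[OF n s] by blast
    have "lam 1 * D1 + lam 2 * D2 \<le> lam 1 * (- l 1 s + \<kappa>1 n) + lam 2 * (- l 2 s + \<kappa>2 n)"
      using D(2,4) lam by (intro add_mono mult_left_mono) auto
    then have "lam 1 * D1 + lam 2 * D2 \<le> - \<Lambda> s + (lam 1 * \<kappa>1 n + lam 2 * \<kappa>2 n)"
      by (simp add: \<Lambda>_def algebra_simps)
    then show "\<exists>D. ((\<lambda>t. lam 1 * E 1 n t + lam 2 * E 2 n t) has_real_derivative D) (at s) \<and>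
        D \<le> - \<Lambda> s + (lam 1 * \<kappa>1 n + lam 2 * \<kappa>2 n)"
      using DERIV_add[OF DERIV_cmult[OF D(1)] DERIV_cmult[OF D(3)]] by blast
  qed
  with \<Lambda>_pos[OF t] contra show False by auto
qed

lemma means_equal:
  assumes i: "i \<in> {1, 2}" and t: "t \<in> {0..T}"
  shows "Mean (dens (m i t)) = Mean (dens (m' i t))"
proof -
  have "Mean (dens (m i t)) - Mean (dens (m' i t)) = 0"
  proof (rule continuous_constant_on_closure[where S="{0<..<T}" and f="\<lambda>t. Mean (dens (m i t)) - Mean (dens (m' i t))"])
    show "continuous_on (closure {0<..<T}) (\<lambda>t. Mean (dens (m i t)) - Mean (dens (m' i t)))"
      using T mean_continuous[OF i] by (auto intro!: continuous_intros)
  qed (use T t i means_equal_interior in auto)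
  then show ?thesis by simp
qed

lemma depends_on_means_eq:
  assumes "depends_on_means \<Phi>" "t \<in> {0..T}"
  shows "\<Phi> x (dens (m 1 t)) (dens (m 2 t)) = \<Phi> x (dens (m' 1 t)) (dens (m' 2 t))"
  using assms(2) by (intro depends_on_means_dens[OF assms(1)] pds means_equal) auto

lemma value_functions_equal:
  assumes i: "i \<in> {1, 2}" and t: "t \<in> {0..T}"
  shows "v i t x = v' i t x"
proof -
  obtain L where lip: "L-lipschitz_on UNIV (H i)" using H[OF i] by blast
  obtain C where C: "\<And>t x. t \<in> {0..T} \<Longrightarrow> \<bar>w i t x\<bar> \<le> C * (1 + \<bar>x\<bar>)" using growth[OF i] by blast
  have TT: "T \<in> {0..T}" using T by simp
  have a: "0 \<le> (\<sigma> i)\<^sup>2 / 2" by simp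
  have L: "0 \<le> L" using lip by (rule lipschitz_on_nonneg)
  have wT: "w i T x = 0" for x
    unfolding terminal[OF i] using depends_on_means_eq[OF G[OF i] TT] by simp
  have pde: "\<bar>wt i t x + (\<sigma> i)\<^sup>2 / 2 * wxx i t x\<bar> \<le> L * \<bar>wx i t x\<bar>" if t: "t \<in> {0<..<T}" for t x
  proof -
    have "coupling_diff i t x = 0"
      unfolding coupling_diff_def using depends_on_means_eq[of "F i" t x] F[OF i] t by auto
    then show ?thesis unfolding hjb(3)[OF i t]
      using lipschitz_onD[OF lip, of "dx (v i) t x" "dx (v' i) t x"] by (simp add: dist_real_def)
  qed
  have interior: "w i t x = 0" if t: "t \<in> {0<..<T}" for t x
  proof (rule antisym)
    show "w i t x \<le> 0"
    proof (rule parabolic_comparison[OF a L w_cont(1)[OF i] w_derivs(1)[OF i] w_derivs(2)[OF i] w_derivs(3)[OF i] _ _ _ t])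
      show "w i t x \<le> C * (1 + \<bar>x\<bar>)" if "t \<in> {0..T}" for t x using C[OF that, of x] by linarith
      show "- L * \<bar>wx i t x\<bar> \<le> wt i t x + (\<sigma> i)\<^sup>2 / 2 * wxx i t x" if "t \<in> {0<..<T}" for t x
        using pde[OF that, of x] by (simp add: abs_le_iff)
    qed (use wT in auto)
    have "- w i t x \<le> 0"
    proof (rule parabolic_comparison[OF a L _ DERIV_minus[OF w_derivs(1)[OF i]] DERIV_minus[OF w_derivs(2)[OF i]]
          DERIV_minus[OF w_derivs(3)[OF i]] _ _ _ t])
      show "continuous_on ({0..T} \<times> UNIV) (\<lambda>(t, x). - w i t x)"
        using continuous_on_minus[OF w_cont(1)[OF i]] by (simp only: split_def)
      show "- w i t x \<le> C * (1 + \<bar>x\<bar>)" if "t \<in> {0..T}" for t x using C[OF that, of x] by linarith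
      show "- L * \<bar>- wx i t x\<bar> \<le> - wt i t x + (\<sigma> i)\<^sup>2 / 2 * - wxx i t x" if "t \<in> {0<..<T}" for t x
        using pde[OF that, of x] by (simp only: mult_minus_left mult_minus_right abs_minus_cancel abs_le_iff) linarith
    qed (use wT in auto)
    then show "0 \<le> w i t x" by simp
  qed
  have "w i t x = 0"
  proof (rule continuous_constant_on_closure[where S="{0<..<T}" and f="\<lambda>t. w i t x"])
    have "continuous_on {0..T} (\<lambda>t. (\<lambda>(t, x). w i t x) (t, x))"
      by (rule continuous_on_compose2[OF w_cont(1)[OF i]]) (auto intro!: continuous_intros)
    then show "continuous_on (closure {0<..<T}) (\<lambda>t. w i t x)" using T by simp
  qed (use T t interior in auto)
  then show ?thesis by simp
qed

lemma densities_equal: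
  assumes i: "i \<in> {1, 2}" and t: "t \<in> {0..T}"
  shows "m i t x = m' i t x"
proof -
  obtain L where lip: "L-lipschitz_on UNIV (H i)" using H[OF i] by blast
  interpret A: fokker_planck T "(\<sigma> i)\<^sup>2 / 2" L "m i" "dt (m i)" "dx (m i)" "dxx (m i)"
    "\<lambda>t x. deriv (H i) (dx (v i) t x) * m i t x" by (rule fp(1)[OF i lip])
  interpret B: fokker_planck T "(\<sigma> i)\<^sup>2 / 2" L "m' i" "dt (m' i)" "dx (m' i)" "dxx (m' i)"
    "\<lambda>t x. deriv (H i) (dx (v' i) t x) * m' i t x" by (rule fp(2)[OF i lip])
  have dx_eq: "dx (v' i) t x = dx (v i) t x" if "t \<in> {0<..<T}" for t x
  proof -
    have "v' i t = v i t" using value_functions_equal[OF i, of t] that by auto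
    then show ?thesis by (simp add: dx_def)
  qed
  define h where "h t x = deriv (H i) (dx (v i) t x) * m i t x - deriv (H i) (dx (v' i) t x) * m' i t x" for t x
  have h: "h t x = deriv (H i) (dx (v i) t x) * (m i t x - m' i t x)" if "t \<in> {0<..<T}" for t x
    unfolding h_def dx_eq[OF that] by (simp add: algebra_simps)
  have "m i t x - m' i t x = 0"
  proof (rule kato_uniqueness[where n="\<lambda>t x. m i t x - m' i t x" and nt="\<lambda>t x. dt (m i) t x - dt (m' i) t x"
        and nx="\<lambda>t x. dx (m i) t x - dx (m' i) t x" and nxx="\<lambda>t x. dxx (m i) t x - dxx (m' i) t x"
        and a="(\<sigma> i)\<^sup>2 / 2" and L=L and M=2 and h=h, OF T _ A.L _ _ _ _ _ _ _ _ _ t])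
    show "0 < (\<sigma> i)\<^sup>2 / 2" using \<sigma>[OF i] by simp
    show "continuous_on ({0..T} \<times> UNIV) (\<lambda>(t, x). m i t x - m' i t x)"
      "continuous_on ({0<..<T} \<times> UNIV) (\<lambda>(t, x). dt (m i) t x - dt (m' i) t x)"
      using continuous_on_diff[OF A.m_cont B.m_cont] continuous_on_diff[OF A.mt_cont B.mt_cont]
      by (simp_all only: split_def)
    show "m i 0 x - m' i 0 x = 0" for x using initial[OF i] by simp
    fix t x assume t: "t \<in> {0<..<T}"
    show "((\<lambda>s. m i s x - m' i s x) has_real_derivative dt (m i) t x - dt (m' i) t x) (at t)"
      "((\<lambda>x. m i t x - m' i t x) has_real_derivative dx (m i) t x - dx (m' i) t x) (at x)"
      "((\<lambda>x. dx (m i) t x - dx (m' i) t x) has_real_derivative dxx (m i) t x - dxx (m' i) t x) (at x)"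
      by (rule DERIV_diff[OF A.mt[OF t] B.mt[OF t]] DERIV_diff[OF A.mx[OF t] B.mx[OF t]]
          DERIV_diff[OF A.mxx[OF t] B.mxx[OF t]])+
    show "\<bar>h t x\<bar> \<le> L * \<bar>m i t x - m' i t x\<bar>"
      unfolding h[OF t] abs_mult
      by (intro mult_right_mono lipschitz_deriv_bound[OF lip] hjb(1)[OF i t]) auto
    show "(h t has_real_derivative dt (m i) t x - dt (m' i) t x - (\<sigma> i)\<^sup>2 / 2 * (dxx (m i) t x - dxx (m' i) t x)) (at x)"
      unfolding h_def using DERIV_diff[OF A.flux_deriv[OF t] B.flux_deriv[OF t], of x]
      by (simp add: algebra_simps)
  next
    fix t R assume t: "t \<in> {0..T}"
    have "integral {- R..R} (\<lambda>x. \<bar>m i t x - m' i t x\<bar>) \<le> integral {- R..R} (\<lambda>x. m i t x + m' i t x)"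
      using A.nonneg[OF t] B.nonneg[OF t]
      by (intro integral_le integrable_continuous_interval continuous_intros A.m_slice[OF t] B.m_slice[OF t])
        (simp add: abs_le_iff)
    also have "\<dots> = integral {- R..R} (m i t) + integral {- R..R} (m' i t)"
      by (intro integral_add integrable_continuous_interval A.m_slice[OF t] B.m_slice[OF t])
    also have "\<dots> \<le> 2" using A.mass_le_1[OF t] B.mass_le_1[OF t] by (smt (verit))
    finally show "integral {- R..R} (\<lambda>x. \<bar>m i t x - m' i t x\<bar>) \<le> 2" .
  qed
  then show ?thesis by simp
qed

end

theorem theorem5:
  fixes H :: "nat \<Rightarrow> real \<Rightarrow> real" and \<sigma> lam :: "nat \<Rightarrow> real"
    and \<nu> :: "nat \<Rightarrow> real \<Rightarrow> real"
    and F G :: "nat \<Rightarrow> real \<Rightarrow> real measure \<Rightarrow> real measure \<Rightarrow> real"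
    and T :: real
    and v m v' m' :: "nat \<Rightarrow> real \<Rightarrow> real \<Rightarrow> real"
  assumes "T > 0"
    and "\<forall>i\<in>{1,2}. convex_on UNIV (H i) \<and> (\<exists>L. L-lipschitz_on UNIV (H i))"
    and "\<forall>i\<in>{1,2}. \<sigma> i > 0"
    and "\<forall>i\<in>{1,2}. pdens1 (\<nu> i)"
    and "\<forall>i\<in>{1,2}. depends_on_means (F i) \<and> linear_growth (F i)"
    and "\<forall>i\<in>{1,2}. depends_on_means (G i) \<and> linear_growth (G i)"
    and "lam 1 > 0" and "lam 2 > 0"
    and "\<forall>p1 p2 q1 q2. pdens1 p1 \<and> pdens1 p2 \<and> pdens1 q1 \<and> pdens1 q2 \<and>
           C2fun p1 \<and> C2fun p2 \<and> C2fun q1 \<and> C2fun q2 \<and>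
           (Mean (dens p1) \<noteq> Mean (dens q1) \<or> Mean (dens p2) \<noteq> Mean (dens q2))
           \<longrightarrow> LL_sum lam F (dens p1) (dens p2) (dens q1) (dens q2) > 0"
    and "\<forall>p1 p2 q1 q2. pdens1 p1 \<and> pdens1 p2 \<and> pdens1 q1 \<and> pdens1 q2 \<and>
           C2fun p1 \<and> C2fun p2 \<and> C2fun q1 \<and> C2fun q2
           \<longrightarrow> LL_sum lam G (dens p1) (dens p2) (dens q1) (dens q2) \<ge> 0"
    and "MFG_solution T H \<sigma> F G \<nu> v m"
    and "MFG_solution T H \<sigma> F G \<nu> v' m'"
  shows "\<forall>i\<in>{1,2}. \<forall>t\<in>{0..T}. \<forall>x. v i t x = v' i t x \<and> m i t x = m' i t x"
proof -
  interpret mfg_pair H \<sigma> lam \<nu> F G T v m v' m'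
    by unfold_locales (use assms in blast)+
  show ?thesis using value_functions_equal densities_equal by blast
qed

end
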